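(* Let $g\in L^2(\mathbf{R})$ and suppose that the Gabor system $\{\pi(p,q)g : p\in\mathcal{P},\ q\in\Lambda\}$, where $\pi(p,q)g(x)=e^{2\pi i\langle p,x\rangle}g(x-q)$, is a $\varsigma$-frame of $L^2(\mathbf{R})$ with constants $0<A\le B<\infty$. Then $$A\le\int_{\mathcal{P}}|\widehat{g}(\xi-p)|^2\,d\varsigma(p)\le B\qquad\text{for a.e. }\xi\in\widehat{\mathbf{R}}.$$
   Context: $\mathbf{R}$ is a locally compact second countable abelian group (not necessarily the real line) with Haar measure $\mu_{\mathbf{R}}$; $\widehat{\mathbf{R}}$ is its dual group, written additively, and the value of the character $p\in\widehat{\mathbf{R}}$ at $x\in\mathbf{R}$ is written $e^{2\pi i\langle p,x\rangle}\in\mathbb{T}$. $\widehat g$ is the Fourier transform $\widehat g(\xi)=\int_{\mathbf{R}}g(x)e^{-2\pi i\langle\xi,x\rangle}d\mu_{\mathbf{R}}(x)$, extended to $L^2(\mathbf{R})$; "a.e." refers to Haar measure $\nu_{\widehat{\mathbf{R}}}$ on $\widehat{\mathbf{R}}$, normalized so that the Fourier transform is unitary on $L^2$. $\Lambda$ is a closed cocompact subgroup of $\mathbf{R}$ with Haar measure $\mu_\Lambda$ normalized so that $\int_{\mathbf{R}}f\,d\mu_{\mathbf{R}}=\int_\Lambda\int_{\mathbf{R}/\Lambda}f(y+q)\,d\kappa(y)\,d\mu_\Lambda(q)$, with $\kappa$ the Haar probability measure on $\mathbf{R}/\Lambda$. $\widehat{\mathbf{R}}$ has a translation-invariant metric $d_{\widehat{\mathbf{R}}}$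 inducing its topology, whose closed balls are compact, and which is weakly doubling: there are $r_0,C>0$ with $\nu_{\widehat{\mathbf{R}}}(B(\mathrm{e},2r))\le C\,\nu_{\widehat{\mathbf{R}}}(B(\mathrm{e},r))$ for all $r<r_0$, where $\mathrm{e}$ is the identity of $\widehat{\mathbf{R}}$. $\mathcal{P}\subset\widehat{\mathbf{R}}$ is endowed with a $\sigma$-finite Borel measure $\varsigma$ such that $(x,p)\mapsto e^{2\pi i\langle p,x\rangle}$ is measurable on $\mathbf{R}\times\mathcal{P}$ and $p\mapsto d_{\widehat{\mathbf{R}}}(p,\mathrm{e})$ is $\varsigma$-measurable on $\mathcal{P}$. The system is a $\varsigma$-frame of $L^2(\mathbf{R})$ with constants $A,B$ if $A\|u\|^2\le\int_{\mathcal{P}}\int_\Lambda|\langle u,\pi(p,q)g\rangle_{L^2(\mathbf{R})}|^2d\mu_\Lambda(q)\,d\varsigma(p)\le B\|u\|^2$ for all $u\in L^2(\mathbf{R})$. *)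

theory Defs
  imports "HOL-Analysis.Analysis"
begin

typedef (overloaded) ('a::topological_ab_group_add) dual =
  "{p :: 'a \<Rightarrow> complex. continuous_on UNIV p \<and> (\<forall>x. cmod (p x) = 1) \<and> (\<forall>x y. p (x + y) = p x * p y)}"
  morphisms pairing Abs_dual
  by (rule exI[of _ "\<lambda>_. 1"]) auto

setup_lifting type_definition_dual

text \<open>\<^term>\<open>pairing p x\<close> is the value \<open>e^(2 \<pi> i \<langle>p, x\<rangle>)\<close> of the character \<open>p\<close> at \<open>x\<close>.
  The group of characters, under pointwise multiplication, is written additively.\<close>

instantiation dual :: (topological_ab_group_add) ab_group_add
begin

lift_definition zero_dual :: "'a dual" is "\<lambda>_. 1" by auto

lift_definition plus_dual :: "'a dual \<Rightarrow> 'a dual \<Rightarrow> 'a dual" is "\<lambda>p p' x. p x * p' x"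
  by (auto intro!: continuous_intros simp: norm_mult)

lift_definition uminus_dual :: "'a dual \<Rightarrow> 'a dual" is "\<lambda>p x. cnj (p x)"
  by (auto intro!: continuous_intros)

lift_definition minus_dual :: "'a dual \<Rightarrow> 'a dual \<Rightarrow> 'a dual" is "\<lambda>p p' x. p x * cnj (p' x)"
  by (auto intro!: continuous_intros simp: norm_mult)

instance
proof
  fix p :: "'a dual"
  show "- p + p = 0"
    by transfer (simp add: mult.commute[of "cnj _"] flip: complex_norm_square)
qed (transfer; simp add: ac_simps fun_eq_iff)+

end

text \<open>The dual carries the compact-open topology.\<close>

instantiation dual :: (topological_ab_group_add) topological_space
begin

definition open_dual :: "'a dual set \<Rightarrow> bool" where
  "open_dual = generate_topology
     {{p. \<forall>x\<in>K. pairing p x \<in> U} | K U. compact K \<and> open U}"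

instance
  by standard
    (auto simp: open_dual_def intro: generate_topology.UNIV generate_topology.Int generate_topology.UN)

end

definition additive_subgroup :: "'a::ab_group_add set \<Rightarrow> bool" where
  "additive_subgroup L \<longleftrightarrow> 0 \<in> L \<and> (\<forall>x\<in>L. \<forall>y\<in>L. x + y \<in> L) \<and> (\<forall>x\<in>L. - x \<in> L)"

text \<open>The points of the quotient by \<open>L\<close> are the cosets \<^term>\<open>x +o L\<close>.\<close>

definition quotient_topology :: "'a::topological_ab_group_add set \<Rightarrow> 'a set topology" where
  "quotient_topology L =
     topology (\<lambda>W. W \<subseteq> range (\<lambda>x. x +o L) \<and> open ((\<lambda>x. x +o L) -` W))"

lemma openin_quotient_topology:
  "openin (quotient_topology L) W \<longleftrightarrow>
     W \<subseteq> range (\<lambda>x. x +o L) \<and> open ((\<lambda>x. x +o L) -` W)"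
proof -
  have "istopology (\<lambda>W. W \<subseteq> range (\<lambda>x. x +o L) \<and> open ((\<lambda>x. x +o L) -` W))"
    unfolding istopology_def by (auto simp: vimage_Union)
  then show ?thesis
    by (simp add: quotient_topology_def)
qed

lemma topspace_quotient_topology: "topspace (quotient_topology L) = range (\<lambda>x. x +o L)"
proof
  have "(\<lambda>x. x +o L) -` range (\<lambda>x. x +o L) = UNIV"
    by auto
  then have "openin (quotient_topology L) (range (\<lambda>x. x +o L))"
    unfolding openin_quotient_topology by simp
  then show "range (\<lambda>x. x +o L) \<subseteq> topspace (quotient_topology L)"
    by (rule openin_subset)
  show "topspace (quotient_topology L) \<subseteq> range (\<lambda>x. x +o L)"
    using openin_topspace[of "quotient_topology L"] unfolding openin_quotient_topology by blast
qed

lemma quotient_map_quotient_topology: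
  "quotient_map euclidean (quotient_topology L) (\<lambda>x. x +o L)"
  unfolding quotient_map_def topspace_quotient_topology openin_quotient_topology vimage_def by simp

text \<open>Haar measures of the topological abelian group with topology \<open>T\<close> and addition \<open>add\<close>.
  All groups considered below are locally compact, Hausdorff and second countable, so that
  regularity follows from finiteness on compact sets and need not be required. For quotients,
  \<open>add\<close> is the elementwise sum of cosets.\<close>

definition haar_measure :: "'g topology \<Rightarrow> ('g \<Rightarrow> 'g \<Rightarrow> 'g) \<Rightarrow> 'g measure \<Rightarrow> bool" where
  "haar_measure T add M \<longleftrightarrow>
     space M = topspace T \<and> sets M = sigma_sets (topspace T) {U. openin T U} \<and>
     (\<forall>K. compactin T K \<longrightarrow> emeasure M K < \<infinity>) \<and>
     (\<forall>U. openin T U \<and> U \<noteq> {} \<longrightarrow> emeasure M U > 0) \<and>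
     (\<forall>x\<in>topspace T. \<forall>A\<in>sets M. emeasure M (add x ` A) = emeasure M A)"

text \<open>Weil's formula. The inner integral depends only on the coset \<open>Y\<close>, not on the choice of its
  representative, by invariance of \<open>\<mu>\<^sub>\<Lambda>\<close>; the order of integration is the one for which no
  Borel choice of representatives is needed.\<close>

definition weil_formula :: "'a::topological_ab_group_add measure \<Rightarrow> 'a measure \<Rightarrow> 'a set measure \<Rightarrow> bool" where
  "weil_formula \<mu> \<mu>\<^sub>\<Lambda> \<kappa> \<longleftrightarrow>
     (\<forall>f :: 'a \<Rightarrow> ennreal. f \<in> borel_measurable borel \<longrightarrow>
        (\<integral>\<^sup>+x. f x \<partial>\<mu>) = (\<integral>\<^sup>+Y. (\<integral>\<^sup>+q. f ((SOME y. y \<in> Y) + q) \<partial>\<mu>\<^sub>\<Lambda>) \<partial>\<kappa>))"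

definition weakly_doubling :: "('b::ab_group_add \<Rightarrow> 'b \<Rightarrow> real) \<Rightarrow> 'b measure \<Rightarrow> bool" where
  "weakly_doubling d M \<longleftrightarrow>
     (\<exists>r0>0. \<exists>C>0. \<forall>r. 0 < r \<and> r < r0 \<longrightarrow>
        emeasure M (Metric_space.mball UNIV d 0 (2 * r))
          \<le> ennreal C * emeasure M (Metric_space.mball UNIV d 0 r))"

definition L1_functions :: "'x measure \<Rightarrow> ('x \<Rightarrow> complex) set" where
  "L1_functions M = {u. integrable M u}"

definition L2_functions :: "'x measure \<Rightarrow> ('x \<Rightarrow> complex) set" where
  "L2_functions M = {u \<in> borel_measurable M. integrable M (\<lambda>x. (cmod (u x))\<^sup>2)}"

definition L2_inner :: "'x measure \<Rightarrow> ('x \<Rightarrow> complex) \<Rightarrow> ('x \<Rightarrow> complex) \<Rightarrow> complex" where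
  "L2_inner M u v = (LINT x|M. u x * cnj (v x))"

definition L2_norm :: "'x measure \<Rightarrow> ('x \<Rightarrow> complex) \<Rightarrow> real" where
  "L2_norm M u = sqrt (LINT x|M. (cmod (u x))\<^sup>2)"

definition fourier :: "'a::topological_ab_group_add measure \<Rightarrow> ('a \<Rightarrow> complex) \<Rightarrow> 'a dual \<Rightarrow> complex" where
  "fourier \<mu> f \<xi> = (LINT x|\<mu>. f x * cnj (pairing \<xi> x))"

text \<open>\<open>G\<close> represents the extension by continuity of the Fourier transform, evaluated at \<open>g\<close>.\<close>

definition is_fourier_L2 ::
  "'a::topological_ab_group_add measure \<Rightarrow> 'a dual measure \<Rightarrow> ('a \<Rightarrow> complex) \<Rightarrow> ('a dual \<Rightarrow> complex) \<Rightarrow> bool" where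
  "is_fourier_L2 \<mu> \<nu> g G \<longleftrightarrow> G \<in> L2_functions \<nu> \<and>
     (\<exists>f :: nat \<Rightarrow> 'a \<Rightarrow> complex.
        (\<forall>n. f n \<in> L1_functions \<mu> \<inter> L2_functions \<mu> \<and> fourier \<mu> (f n) \<in> L2_functions \<nu>) \<and>
        (\<lambda>n. L2_norm \<mu> (\<lambda>x. f n x - g x)) \<longlonglongrightarrow> 0 \<and>
        (\<lambda>n. L2_norm \<nu> (\<lambda>\<xi>. fourier \<mu> (f n) \<xi> - G \<xi>)) \<longlonglongrightarrow> 0)"

definition fourier_L2 ::
  "'a::topological_ab_group_add measure \<Rightarrow> 'a dual measure \<Rightarrow> ('a \<Rightarrow> complex) \<Rightarrow> 'a dual \<Rightarrow> complex" where
  "fourier_L2 \<mu> \<nu> g = (SOME G. is_fourier_L2 \<mu> \<nu> g G)"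

text \<open>Isometry is imposed on the dense subspace of integrable functions, and passes to the
  extension by continuity.\<close>

definition fourier_unitary :: "'a::topological_ab_group_add measure \<Rightarrow> 'a dual measure \<Rightarrow> bool" where
  "fourier_unitary \<mu> \<nu> \<longleftrightarrow>
     (\<forall>f \<in> L1_functions \<mu> \<inter> L2_functions \<mu>.
        fourier \<mu> f \<in> L2_functions \<nu> \<and> L2_norm \<nu> (fourier \<mu> f) = L2_norm \<mu> f) \<and>
     (\<forall>G \<in> L2_functions \<nu>. \<exists>f \<in> L2_functions \<mu>. AE \<xi> in \<nu>. fourier_L2 \<mu> \<nu> f \<xi> = G \<xi>)"

definition tf_shift :: "'a::topological_ab_group_add dual \<Rightarrow> 'a \<Rightarrow> ('a \<Rightarrow> complex) \<Rightarrow> 'a \<Rightarrow> complex" where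
  "tf_shift p q g x = pairing p x * g (x - q)"

text \<open>The index set of the frequency shifts is \<open>space \<sigma>\<close>, that of the translations
  is \<^term>\<open>space \<mu>\<^sub>\<Lambda>\<close>.\<close>

definition gabor_frame ::
  "'a::topological_ab_group_add measure \<Rightarrow> 'a measure \<Rightarrow> 'a dual measure \<Rightarrow> ('a \<Rightarrow> complex) \<Rightarrow> real \<Rightarrow> real \<Rightarrow> bool" where
  "gabor_frame \<mu> \<mu>\<^sub>\<Lambda> \<sigma> g A B \<longleftrightarrow>
     (\<forall>u \<in> L2_functions \<mu>.
        (let E = (\<integral>\<^sup>+p. (\<integral>\<^sup>+q. ennreal ((cmod (L2_inner \<mu> u (tf_shift p q g)))\<^sup>2) \<partial>\<mu>\<^sub>\<Lambda>) \<partial>\<sigma>)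
         in ennreal (A * (L2_norm \<mu> u)\<^sup>2) \<le> E \<and> E \<le> ennreal (B * (L2_norm \<mu> u)\<^sup>2)))"

end

theory Submission
  imports Defs
begin

text \<open>Write \<open>G\<close> for the Fourier transform of \<open>g\<close>. The frame inequality holds for all
  translates of a function \<open>u\<close>, which amounts to replacing \<open>\<Lambda>\<close> by its cosets. Averaging over
  the cosets with Weil's formula turns the integral over \<open>\<Lambda>\<close> into an integral over the whole
  group, and Plancherel's theorem evaluates \<open>\<integral> |\<langle>u, \<pi>(p,x) g\<rangle>|\<^sup>2 dx\<close> as
  \<open>\<integral> |\<^bold>F u(\<xi>)|\<^sup>2 |G(\<xi> - p)|\<^sup>2 d\<xi>\<close>. Hence the function
  \<open>\<Phi>(\<xi>) = \<integral> |G(\<xi> - p)|\<^sup>2 d\<sigma>(p)\<close> satisfies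
  \<open>A \<parallel>H\<parallel>\<^sup>2 \<le> \<integral> |H|\<^sup>2 \<Phi> \<le> B \<parallel>H\<parallel>\<^sup>2\<close> for all square integrable \<open>H\<close>, and indicator functions
  \<open>H\<close> give the bounds for \<open>\<Phi>\<close> almost everywhere.\<close>

section \<open>Square integrable functions\<close>

text \<open>The inequality for \<open>H\<close> is first available only for Fourier transforms of
  functions that are both integrable and square integrable, and at that stage nothing else is known
  about \<open>\<Phi>\<close>, not even finiteness. Passing to indicator functions therefore needs
  convergence in two measures at once, \<open>\<nu>\<close> and \<open>density \<nu> \<Phi>\<close>.
  It comes from the upper bound applied to differences of approximants, an almost everywhere
  convergent subsequence and Fatou's lemma. The same mechanism carries Plancherel's theorem for
  correlations from integrable \<open>g\<close> to square integrable \<open>g\<close>. The constants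
  survive the averaging because the averaging weight has total mass 1; this is the one place where
  Weil's formula and the normalization of \<open>\<kappa>\<close> enter. The dual is a type with
  only its group operations and the compact-open topology, so countability and measurability facts
  about it are drawn from the invariant metric.\<close>

definition sqn :: "'x measure \<Rightarrow> ('x \<Rightarrow> complex) \<Rightarrow> ennreal" where
  "sqn M f = (\<integral>\<^sup>+x. ennreal ((cmod (f x))\<^sup>2) \<partial>M)"

lemma L2_functions_iff_sqn: "f \<in> L2_functions M \<longleftrightarrow> f \<in> borel_measurable M \<and> sqn M f < \<infinity>"
  unfolding L2_functions_def sqn_def by (auto simp: integrable_iff_bounded)

lemma L2_functions_measurable: "f \<in> L2_functions M \<Longrightarrow> f \<in> borel_measurable M"
  by (simp add: L2_functions_def)

lemma L2_norm_nonneg: "0 \<le> L2_norm M f"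
  by (simp add: L2_norm_def)

text \<open>Membership matters: outside \<open>L2_functions\<close> the Bochner integral may default
  to 0, and \<open>L2_norm\<close> with it. Estimates are therefore made with the extended value
  \<open>sqn\<close> and translated only at the end.\<close>

lemma sqn_eq_L2_norm:
  assumes "f \<in> L2_functions M"
  shows "sqn M f = ennreal ((L2_norm M f)\<^sup>2)"
  using assms unfolding sqn_def L2_norm_def L2_functions_def
  by (simp add: nn_integral_eq_integral)

text \<open>Young's inequality for the cross term. The free parameter \<open>e\<close> makes this a
  substitute for Minkowski's inequality: as \<open>e\<close> tends to 0, the factor of the main term
  tends to 1.\<close>

lemma cmod_square_le_weighted:
  fixes a b :: complex
  assumes e: "0 < e"
  shows "(cmod a)\<^sup>2 \<le> (1 + e) * (cmod b)\<^sup>2 + (1 + 1/e) * (cmod (a - b))\<^sup>2"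
proof -
  define s t where "s = cmod b" and "t = cmod (a - b)"
  have "cmod a \<le> s + t"
    using norm_triangle_ineq[of b "a - b"] by (simp add: s_def t_def)
  then have "(cmod a)\<^sup>2 \<le> (s + t)\<^sup>2"
    by (rule power_mono) simp
  also have "\<dots> = (1 + e) * s\<^sup>2 + (1 + 1/e) * t\<^sup>2 - (e * s - t)\<^sup>2 / e"
    using e by (simp add: field_simps power2_eq_square)
  also have "\<dots> \<le> (1 + e) * s\<^sup>2 + (1 + 1/e) * t\<^sup>2"
    using e by simp
  finally show ?thesis by (simp add: s_def t_def)
qed

lemma sqn_le_weighted:
  assumes [measurable]: "f \<in> borel_measurable M" "h \<in> borel_measurable M" and e: "0 < e"
  shows "sqn M f \<le> ennreal (1 + e) * sqn M h + ennreal (1 + 1/e) * sqn M (\<lambda>x. f x - h x)"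
proof -
  have "sqn M f \<le> (\<integral>\<^sup>+x. ennreal (1 + e) * ennreal ((cmod (h x))\<^sup>2) +
      ennreal (1 + 1/e) * ennreal ((cmod (f x - h x))\<^sup>2) \<partial>M)"
    unfolding sqn_def
  proof (rule nn_integral_mono)
    fix x
    show "ennreal ((cmod (f x))\<^sup>2) \<le> ennreal (1 + e) * ennreal ((cmod (h x))\<^sup>2) +
      ennreal (1 + 1/e) * ennreal ((cmod (f x - h x))\<^sup>2)"
      using cmod_square_le_weighted[OF e, of "f x" "h x"] e
      by (simp flip: ennreal_mult ennreal_plus add: ennreal_leI)
  qed
  also have "\<dots> = ennreal (1 + e) * sqn M h + ennreal (1 + 1/e) * sqn M (\<lambda>x. f x - h x)"
    unfolding sqn_def by (simp add: nn_integral_add nn_integral_cmult)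
  finally show ?thesis .
qed

lemma sqn_diff_commute: "sqn M (\<lambda>x. f x - h x) = sqn M (\<lambda>x. h x - f x)"
  unfolding sqn_def by (simp add: norm_minus_commute)

lemma sqn_diff_le:
  assumes "f \<in> borel_measurable M" "h \<in> borel_measurable M" "k \<in> borel_measurable M"
  shows "sqn M (\<lambda>x. f x - h x) \<le> 2 * sqn M (\<lambda>x. f x - k x) + 2 * sqn M (\<lambda>x. h x - k x)"
proof -
  have "sqn M (\<lambda>x. f x - h x) \<le> ennreal (1 + 1) * sqn M (\<lambda>x. f x - k x) +
     ennreal (1 + 1/1) * sqn M (\<lambda>x. (f x - h x) - (f x - k x))"
    using assms by (intro sqn_le_weighted) auto
  then show ?thesis
    by (simp add: sqn_diff_commute[of M h k])
qed

text \<open>Two weighted triangle inequalities, one in each measure, cost a factor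
  \<open>(1 + e)\<^sup>2\<close> and error terms that vanish as \<open>n\<close> grows; afterwards
  \<open>e\<close> tends to 0. An infinite right-hand side is settled separately.\<close>

lemma sqn_limit_le:
  assumes M: "\<And>n. f n \<in> borel_measurable M" "F \<in> borel_measurable M"
    and N: "\<And>n. h n \<in> borel_measurable N" "H \<in> borel_measurable N"
    and f: "(\<lambda>n. sqn M (\<lambda>x. f n x - F x)) \<longlonglongrightarrow> 0"
    and h: "(\<lambda>n. sqn N (\<lambda>x. h n x - H x)) \<longlonglongrightarrow> 0"
    and le: "\<And>n. sqn M (f n) \<le> ennreal c * sqn N (h n)"
  shows "sqn M F \<le> ennreal c * sqn N H"
proof (cases "ennreal c * sqn N H = top")
  case False
  have step: "sqn M F \<le> (ennreal (1 + e))\<^sup>2 * (ennreal c * sqn N H)" if e: "e > 0" for e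
  proof (rule LIMSEQ_le_const)
    let ?R = "\<lambda>n. ennreal (1 + e) * (ennreal c * (ennreal (1 + e) * sqn N H +
        ennreal (1 + 1/e) * sqn N (\<lambda>x. h n x - H x))) + ennreal (1 + 1/e) * sqn M (\<lambda>x. f n x - F x)"
    have "?R \<longlonglongrightarrow> ennreal (1 + e) * (ennreal c * (ennreal (1 + e) * sqn N H +
        ennreal (1 + 1/e) * 0)) + ennreal (1 + 1/e) * 0"
      by (intro tendsto_add tendsto_const ennreal_tendsto_cmult f h) auto
    then show "?R \<longlonglongrightarrow> (ennreal (1 + e))\<^sup>2 * (ennreal c * sqn N H)"
      by (simp add: power2_eq_square ac_simps)
    have "sqn M F \<le> ?R n" for n
    proof -
      have "sqn M F \<le> ennreal (1 + e) * sqn M (f n) + ennreal (1 + 1/e) * sqn M (\<lambda>x. F x - f n x)"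
        by (intro sqn_le_weighted M e)
      also have "\<dots> \<le> ennreal (1 + e) * (ennreal c * sqn N (h n)) +
          ennreal (1 + 1/e) * sqn M (\<lambda>x. f n x - F x)"
        by (subst sqn_diff_commute) (intro add_mono mult_left_mono le order_refl, auto)
      also have "\<dots> \<le> ?R n"
        by (intro add_mono mult_left_mono order_refl sqn_le_weighted N e) auto
      finally show ?thesis .
    qed
    then show "\<exists>N. \<forall>n\<ge>N. sqn M F \<le> ?R n" by blast
  qed
  \<comment> \<open>With a finite real value \<open>r\<close>, the remaining limit along
    \<open>e = 1 / Suc n\<close> can be taken in the reals.\<close>
  define r where "r = enn2real (ennreal c * sqn N H)"
  have r: "ennreal c * sqn N H = ennreal r"
    using False by (simp add: r_def top.not_eq_extremum)
  have r0: "0 \<le> r" by (simp add: r_def)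
  show ?thesis
  proof (rule LIMSEQ_le_const)
    have "(\<lambda>n. ennreal ((1 + 1 / real (Suc n))\<^sup>2 * r)) \<longlonglongrightarrow> ennreal ((1 + 0)\<^sup>2 * r)"
      by (intro tendsto_intros LIMSEQ_Suc[OF lim_1_over_n])
    then show "(\<lambda>n. ennreal ((1 + 1 / real (Suc n))\<^sup>2 * r)) \<longlonglongrightarrow> ennreal c * sqn N H"
      by (simp add: r)
    have "sqn M F \<le> ennreal ((1 + 1 / real (Suc n))\<^sup>2 * r)" for n
      using step[of "1 / real (Suc n)"] r0
      by (simp add: r ennreal_mult power2_eq_square del: of_nat_Suc)
    then show "\<exists>N. \<forall>n\<ge>N. sqn M F \<le> ennreal ((1 + 1 / real (Suc n))\<^sup>2 * r)" by blast
  qed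
qed simp

lemma sqn_Fatou:
  assumes [measurable]: "\<And>n. f n \<in> borel_measurable M" "h \<in> borel_measurable M" 
    and lim: "AE x in M. (\<lambda>n. f n x) \<longlonglongrightarrow> F x"
    and bound: "\<forall>\<^sub>F n in sequentially. sqn M (\<lambda>x. f n x - h x) \<le> c"
  shows "sqn M (\<lambda>x. F x - h x) \<le> c"
proof -
  have "sqn M (\<lambda>x. F x - h x) = (\<integral>\<^sup>+x. liminf (\<lambda>n. ennreal ((cmod (f n x - h x))\<^sup>2)) \<partial>M)"
    unfolding sqn_def
  proof (rule nn_integral_cong_AE)
    show "AE x in M. ennreal ((cmod (F x - h x))\<^sup>2) = liminf (\<lambda>n. ennreal ((cmod (f n x - h x))\<^sup>2))"
      using lim
    proof eventually_elim
      case (elim x)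
      then have "(\<lambda>n. ennreal ((cmod (f n x - h x))\<^sup>2)) \<longlonglongrightarrow> ennreal ((cmod (F x - h x))\<^sup>2)"
        by (intro tendsto_intros)
      then show ?case
        by (rule lim_imp_Liminf[OF sequentially_bot, symmetric])
    qed
  qed
  also have "\<dots> \<le> liminf (\<lambda>n. sqn M (\<lambda>x. f n x - h x))"
    unfolding sqn_def by (rule nn_integral_liminf) measurable
  also have "\<dots> \<le> c"
    using Liminf_mono[OF bound] by (simp add: Liminf_const)
  finally show ?thesis .
qed

text \<open>Riesz-Fischer for a rapidly Cauchy sequence. The rate \<open>(1/4) ^ n\<close> leaves
  room for weights \<open>2 ^ n\<close>: the weighted sum of squared increments still has finite
  integral, so it is finite almost everywhere, and this forces the increments themselves to be
  absolutely summable.\<close>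

lemma L2_complete:
  fixes f :: "nat \<Rightarrow> 'x \<Rightarrow> complex"
  assumes f: "\<And>n. f n \<in> L2_functions M"
    and cauchy: "\<And>n m. n \<le> m \<Longrightarrow> sqn M (\<lambda>x. f m x - f n x) \<le> ennreal ((1/4) ^ n)"
  obtains F where "F \<in> L2_functions M" "(\<lambda>n. sqn M (\<lambda>x. f n x - F x)) \<longlonglongrightarrow> 0"
proof -
  have [measurable]: "f n \<in> borel_measurable M" for n
    using f by (rule L2_functions_measurable)
  let ?a = "\<lambda>n x. f (Suc n) x - f n x"
  have "(\<integral>\<^sup>+x. (\<Sum>n. ennreal (2 ^ n) * ennreal ((cmod (?a n x))\<^sup>2)) \<partial>M) =
      (\<Sum>n. ennreal (2 ^ n) * sqn M (?a n))"
    unfolding sqn_def by (subst nn_integral_suminf) (auto simp: nn_integral_cmult)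
  also have "\<dots> \<le> (\<Sum>n. ennreal ((1/2) ^ n))"
  proof (intro suminf_le allI)
    fix n
    have "ennreal (2 ^ n) * sqn M (?a n) \<le> ennreal (2 ^ n) * ennreal ((1/4) ^ n)"
      by (intro mult_left_mono cauchy) auto
    also have "\<dots> = ennreal ((1/2) ^ n)"
      by (simp flip: ennreal_mult power_mult_distrib)
    finally show "ennreal (2 ^ n) * sqn M (?a n) \<le> ennreal ((1/2) ^ n)" .
  qed auto
  also have "\<dots> = ennreal (\<Sum>n. (1/2) ^ n)"
    by (rule suminf_ennreal2) (auto intro: summable_geometric)
  finally have "(\<integral>\<^sup>+x. (\<Sum>n. ennreal (2 ^ n) * ennreal ((cmod (?a n x))\<^sup>2)) \<partial>M) \<noteq> \<infinity>"
    by (auto simp: top_unique)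
  then have "AE x in M. (\<Sum>n. ennreal (2 ^ n) * ennreal ((cmod (?a n x))\<^sup>2)) \<noteq> \<infinity>"
    by (intro nn_integral_PInf_AE) auto
  then have "AE x in M. convergent (\<lambda>n. f n x)"
  proof eventually_elim
    case (elim x)
    then have "summable (\<lambda>n. 2 ^ n * (cmod (?a n x))\<^sup>2)"
      by (intro summable_suminf_not_top) (auto simp: ennreal_mult)
    then have "summable (\<lambda>n. (1/2) ^ n + 2 ^ n * (cmod (?a n x))\<^sup>2)"
      by (intro summable_add summable_geometric) auto
    moreover have "norm (?a n x) \<le> (1/2) ^ n + 2 ^ n * (cmod (?a n x))\<^sup>2" for n
    proof -
      define t where "t = cmod (?a n x)"
      \<comment> \<open>Expanding the square and dividing by \<open>2 ^ n\<close> gives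
        \<open>t \<le> (1/2) ^ n + 2 ^ n * t\<^sup>2\<close>, a bound by two summable
        sequences.\<close>
      have "0 \<le> ((2::real) ^ n * t - 1)\<^sup>2 + 2 ^ n * t"
        by (simp add: t_def)
      also have "\<dots> = 2 ^ n * ((1/2) ^ n + 2 ^ n * t\<^sup>2 - t)"
        by (simp add: power2_eq_square algebra_simps power_one_over)
      finally have "0 \<le> (1/2) ^ n + 2 ^ n * t\<^sup>2 - t"
        by (metis mult_zero_right mult_le_cancel_left_pos zero_less_power zero_less_numeral)
      then show ?thesis
        by (simp add: t_def)
    qed
    ultimately have "summable (\<lambda>n. ?a n x)"
      by (rule summable_comparison_test')
    then have "convergent (\<lambda>n. \<Sum>i<n. ?a i x)"
      by (simp add: summable_iff_convergent)
    then have "convergent (\<lambda>n. f n x - f 0 x)"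
      by (simp add: sum_lessThan_telescope[of "\<lambda>n. f n x"])
    then have "convergent (\<lambda>n. (f n x - f 0 x) + f 0 x)"
      by (intro convergent_add convergent_const)
    then show ?case by simp
  qed
  then have lim: "AE x in M. (\<lambda>n. f n x) \<longlonglongrightarrow> lim (\<lambda>n. f n x)"
    by (simp add: convergent_LIMSEQ_iff)
  define F where "F = (\<lambda>x. lim (\<lambda>n. f n x))"
  have F[measurable]: "F \<in> borel_measurable M"
    unfolding F_def by (rule borel_measurable_lim_metric) measurable
  \<comment> \<open>Fatou's lemma in the first index with \<open>n\<close> fixed: the Cauchy bound
    passes from \<open>f m\<close> to the limit.\<close>
  have close: "sqn M (\<lambda>x. F x - f n x) \<le> ennreal ((1/4) ^ n)" for n
    unfolding F_def
    by (rule sqn_Fatou[where f=f]) (auto intro!: lim eventually_sequentiallyI[of n] cauchy)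
  have "sqn M F \<le> ennreal (1 + 1) * sqn M (f 0) + ennreal (1 + 1/1) * sqn M (\<lambda>x. F x - f 0 x)"
    by (intro sqn_le_weighted) auto
  also have "\<dots> < \<infinity>"
    using f[of 0] close[of 0] by (auto simp: L2_functions_iff_sqn ennreal_mult_less_top le_less_trans)
  finally have "F \<in> L2_functions M"
    by (simp add: L2_functions_iff_sqn)
  moreover have "(\<lambda>n. sqn M (\<lambda>x. f n x - F x)) \<longlonglongrightarrow> 0"
  proof (rule tendsto_sandwich[OF _ _ tendsto_const])
    have "(\<lambda>n. ennreal ((1/4) ^ n)) \<longlonglongrightarrow> ennreal 0"
      by (intro tendsto_intros) auto
    then show "(\<lambda>n. ennreal ((1/4) ^ n)) \<longlonglongrightarrow> 0" by simp
  qed (use close in \<open>auto simp: sqn_diff_commute[of M _ F]\<close>)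
  ultimately show ?thesis by (rule that)
qed

text \<open>Small values of \<open>g\<close> are cut off, not large ones: where
  \<open>cmod (g x) \<ge> 1 / Suc n\<close>, one has
  \<open>cmod (g x) \<le> Suc n * (cmod (g x))\<^sup>2\<close>, so the truncation is integrable over
  any measure space. Dominated convergence gives the approximation.\<close>

lemma L1_L2_dense:
  fixes g :: "'x \<Rightarrow> complex"
  assumes g: "g \<in> L2_functions M" and e: "e > 0"
  obtains h where "h \<in> L1_functions M \<inter> L2_functions M" "sqn M (\<lambda>x. h x - g x) \<le> ennreal e"
proof -
  have [measurable]: "g \<in> borel_measurable M"
    using g by (rule L2_functions_measurable)
  have int: "integrable M (\<lambda>x. (cmod (g x))\<^sup>2)"
    using g by (simp add: L2_functions_def)
  define h where "h n x = (if real (Suc n) * cmod (g x) \<ge> 1 then g x else 0)" for n x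
  have [measurable]: "h n \<in> borel_measurable M" for n
    unfolding h_def by measurable
  have "(\<lambda>n. LINT x|M. (cmod (h n x - g x))\<^sup>2) \<longlonglongrightarrow> (LINT x|M. 0)"
  proof (rule integral_dominated_convergence[where w="\<lambda>x. (cmod (g x))\<^sup>2"])
    have "(\<lambda>n. (cmod (h n x - g x))\<^sup>2) \<longlonglongrightarrow> 0" for x
    proof (cases "g x = 0")
      case True
      then show ?thesis by (simp add: h_def)
    next
      case False
      obtain n0 :: nat where n0: "1 / cmod (g x) < real n0"
        using reals_Archimedean2 by blast
      have "(cmod (h n x - g x))\<^sup>2 = 0" if "n \<ge> n0" for n
      proof -
        have "1 / cmod (g x) \<le> real (Suc n)"
          using n0 that by simp
        then show ?thesis
          using False by (simp add: h_def field_simps)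
      qed
      then show ?thesis
        by (intro tendsto_eventually eventually_sequentiallyI[of n0])
    qed
    then show "AE x in M. (\<lambda>n. (cmod (h n x - g x))\<^sup>2) \<longlonglongrightarrow> 0" by simp
    show "AE x in M. norm ((cmod (h n x - g x))\<^sup>2) \<le> (cmod (g x))\<^sup>2" for n
      by (auto simp: h_def)
  qed (use int in auto)
  then obtain n where n: "\<bar>LINT x|M. (cmod (h n x - g x))\<^sup>2\<bar> < e"
    using e by (auto simp: lim_sequentially)
  have "integrable M (h n)"
  proof (rule Bochner_Integration.integrable_bound)
    show "integrable M (\<lambda>x. real (Suc n) * (cmod (g x))\<^sup>2)"
      using int by auto
    have "cmod (h n x) \<le> real (Suc n) * (cmod (g x))\<^sup>2" for x
    proof (cases "real (Suc n) * cmod (g x) \<ge> 1")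
      case True
      then show ?thesis
        using mult_right_mono[OF True, of "cmod (g x)"]
        by (simp add: h_def power2_eq_square mult.assoc del: of_nat_Suc)
    qed (simp add: h_def)
    then show "AE x in M. norm (h n x) \<le> norm (real (Suc n) * (cmod (g x))\<^sup>2)"
      by simp
  qed auto
  moreover have "h n \<in> L2_functions M"
    unfolding L2_functions_def
    using Bochner_Integration.integrable_bound[OF int, of "\<lambda>x. (cmod (h n x))\<^sup>2"] by (auto simp: h_def)
  moreover have "integrable M (\<lambda>x. (cmod (h n x - g x))\<^sup>2)"
    using Bochner_Integration.integrable_bound[OF int, of "\<lambda>x. (cmod (h n x - g x))\<^sup>2"] by (auto simp: h_def)
  then have "sqn M (\<lambda>x. h n x - g x) \<le> ennreal e"
    unfolding sqn_def using n by (subst nn_integral_eq_integral) (auto intro!: ennreal_leI)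
  ultimately show ?thesis
    by (intro that[of "h n"]) (auto simp: L1_functions_def)
qed

lemma L2_functions_diff:
  assumes "f \<in> L2_functions M" "h \<in> L2_functions M"
  shows "(\<lambda>x. f x - h x) \<in> L2_functions M"
  using assms sqn_diff_le[of f M h "\<lambda>_. 0"]
  by (auto simp: L2_functions_iff_sqn ennreal_mult_less_top le_less_trans)

lemma L2_norm_tendsto_0_iff:
  assumes "\<And>n. f n \<in> L2_functions M"
  shows "(\<lambda>n. L2_norm M (f n)) \<longlonglongrightarrow> 0 \<longleftrightarrow> (\<lambda>n. sqn M (f n)) \<longlonglongrightarrow> 0"
proof -
  have "(\<lambda>n. sqn M (f n)) \<longlonglongrightarrow> 0 \<longleftrightarrow> (\<lambda>n. ennreal ((L2_norm M (f n))\<^sup>2)) \<longlonglongrightarrow> ennreal 0"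
    by (simp add: sqn_eq_L2_norm[OF assms])
  also have "\<dots> \<longleftrightarrow> (\<lambda>n. (L2_norm M (f n))\<^sup>2) \<longlonglongrightarrow> 0"
    by (rule tendsto_ennreal_iff) auto
  also have "\<dots> \<longleftrightarrow> (\<lambda>n. L2_norm M (f n)) \<longlonglongrightarrow> 0"
  proof
    assume "(\<lambda>n. (L2_norm M (f n))\<^sup>2) \<longlonglongrightarrow> 0"
    from tendsto_real_sqrt[OF this] show "(\<lambda>n. L2_norm M (f n)) \<longlonglongrightarrow> 0"
      by (simp add: L2_norm_nonneg)
  next
    assume "(\<lambda>n. L2_norm M (f n)) \<longlonglongrightarrow> 0"
    from tendsto_power[OF this, of 2] show "(\<lambda>n. (L2_norm M (f n))\<^sup>2) \<longlonglongrightarrow> 0"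
      by simp
  qed
  finally show ?thesis by simp
qed

lemma L2_AE_subsequence:
  assumes f: "\<And>n. f n \<in> L2_functions M" "F \<in> L2_functions M"
    and lim: "(\<lambda>n. sqn M (\<lambda>x. f n x - F x)) \<longlonglongrightarrow> 0"
  obtains r where "strict_mono r" "AE x in M. (\<lambda>n. f (r n) x) \<longlonglongrightarrow> F x"
proof -
  let ?k = "\<lambda>n x. (cmod (f n x - F x))\<^sup>2"
  have int: "integrable M (?k n)" for n
    using L2_functions_diff[OF f] by (simp add: L2_functions_def)
  have "(\<lambda>n. ennreal (LINT x|M. norm (?k n x))) \<longlonglongrightarrow> ennreal 0"
    using lim int by (simp add: sqn_def nn_integral_eq_integral)
  then have "(\<lambda>n. LINT x|M. norm (?k n x)) \<longlonglongrightarrow> 0"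
    by (subst (asm) tendsto_ennreal_iff) auto
  then obtain r where r: "strict_mono r" "AE x in M. (\<lambda>n. ?k (r n) x) \<longlonglongrightarrow> 0"
    using tendsto_L1_AE_subseq[of M ?k] int by blast
  have "AE x in M. (\<lambda>n. f (r n) x) \<longlonglongrightarrow> F x"
    using r(2)
  proof eventually_elim
    case (elim x)
    then have "(\<lambda>n. sqrt (?k (r n) x)) \<longlonglongrightarrow> sqrt 0" by (intro tendsto_intros)
    then have "(\<lambda>n. f (r n) x - F x) \<longlonglongrightarrow> 0"
      by (simp add: tendsto_norm_zero_iff)
    then show ?case by (simp add: LIM_zero_iff)
  qed
  with r(1) show ?thesis by (rule that)
qed

text \<open>The comparison makes \<open>f\<close> a Cauchy sequence in \<open>M\<close>, and Fatou's
  lemma turns a Cauchy sequence with an almost everywhere limit into a convergent one. The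
  comparison is applied only to members of the sequence, so it can be used before it is known for
  the limits.\<close>

lemma sqn_tendsto_0_transfer:
  assumes f[measurable]: "\<And>n. f n \<in> borel_measurable M" and lim: "AE x in M. (\<lambda>n. f n x) \<longlonglongrightarrow> F x"
    and h[measurable]: "\<And>n. h n \<in> borel_measurable N" "H \<in> borel_measurable N"
    and h_lim: "(\<lambda>n. sqn N (\<lambda>x. h n x - H x)) \<longlonglongrightarrow> 0"
    and le: "\<And>m n. sqn M (\<lambda>x. f m x - f n x) \<le> ennreal c * sqn N (\<lambda>x. h m x - h n x)"
  shows "(\<lambda>n. sqn M (\<lambda>x. f n x - F x)) \<longlonglongrightarrow> 0"
proof (rule tendsto_sandwich[OF _ _ tendsto_const])
  let ?d = "\<lambda>n. sqn N (\<lambda>x. h n x - H x)"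
  \<comment> \<open>For fixed \<open>n\<close> the distance \<open>?d m\<close> is below
    \<open>1 / Suc n\<close> for all large \<open>m\<close>. This gives a bound free of
    \<open>m\<close>, as Fatou's lemma requires, that still tends to 0.\<close>
  let ?b = "\<lambda>n. ennreal c * (2 * ennreal (1 / Suc n) + 2 * ?d n)"
  have "?b \<longlonglongrightarrow> ennreal c * (2 * ennreal 0 + 2 * 0)"
    by (intro ennreal_tendsto_cmult tendsto_add tendsto_ennrealI h_lim LIMSEQ_Suc[OF lim_1_over_n]) auto
  then show "?b \<longlonglongrightarrow> 0" by simp
  have "sqn M (\<lambda>x. f n x - F x) \<le> ?b n" for n
  proof (subst sqn_diff_commute, rule sqn_Fatou[where f = f])
    have "\<forall>\<^sub>F m in sequentially. ?d m < ennreal (1 / Suc n)"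
      by (intro order_tendstoD[OF h_lim]) simp
    then show "\<forall>\<^sub>F m in sequentially. sqn M (\<lambda>x. f m x - f n x) \<le> ?b n"
    proof eventually_elim
      case (elim m)
      have "sqn M (\<lambda>x. f m x - f n x) \<le> ennreal c * sqn N (\<lambda>x. h m x - h n x)"
        by (rule le)
      also have "\<dots> \<le> ennreal c * (2 * ?d m + 2 * ?d n)"
        by (intro mult_left_mono sqn_diff_le) auto
      also have "\<dots> \<le> ?b n"
        using elim by (intro mult_left_mono add_mono) auto
      finally show ?case .
    qed
  qed (use lim in auto)
  then show "\<forall>\<^sub>F n in sequentially. sqn M (\<lambda>x. f n x - F x) \<le> ?b n"
    by simp
qed auto

section \<open>From integral bounds against a density to pointwise bounds\<close>

lemma sqn_density:
  assumes [measurable]: "\<Phi> \<in> borel_measurable \<nu>" "h \<in> borel_measurable \<nu>"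
  shows "sqn (density \<nu> \<Phi>) h = (\<integral>\<^sup>+x. \<Phi> x * ennreal ((cmod (h x))\<^sup>2) \<partial>\<nu>)"
  unfolding sqn_def by (rule nn_integral_density) measurable

text \<open>Convergence in \<open>\<nu>\<close> alone says nothing about
  \<open>density \<nu> \<Phi>\<close>. A subsequence converges almost everywhere for
  \<open>\<nu>\<close>, hence for the density, and the bound on differences then gives convergence
  in the second measure too. Once both limits exist, each bound passes to \<open>H\<close>.\<close>

lemma sqn_density_bounds_limit:
  assumes \<Phi>[measurable]: "\<Phi> \<in> borel_measurable \<nu>" and a: "0 < a"
    and h: "\<And>n. h n \<in> L2_functions \<nu>" "H \<in> L2_functions \<nu>"
    and lim: "(\<lambda>n. sqn \<nu> (\<lambda>x. h n x - H x)) \<longlonglongrightarrow> 0"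
    and lower: "\<And>n. ennreal a * sqn \<nu> (h n) \<le> sqn (density \<nu> \<Phi>) (h n)"
    and upper: "\<And>n. sqn (density \<nu> \<Phi>) (h n) \<le> ennreal b * sqn \<nu> (h n)"
    and diff: "\<And>m n. sqn (density \<nu> \<Phi>) (\<lambda>x. h m x - h n x) \<le> ennreal b * sqn \<nu> (\<lambda>x. h m x - h n x)"
  shows "ennreal a * sqn \<nu> H \<le> sqn (density \<nu> \<Phi>) H" "sqn (density \<nu> \<Phi>) H \<le> ennreal b * sqn \<nu> H"
proof -
  obtain r where r: "strict_mono r" "AE x in \<nu>. (\<lambda>n. h (r n) x) \<longlonglongrightarrow> H x"
    using L2_AE_subsequence[OF h lim] .
  have r_lim: "(\<lambda>n. sqn \<nu> (\<lambda>x. h (r n) x - H x)) \<longlonglongrightarrow> 0"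
    using LIMSEQ_subseq_LIMSEQ[OF lim r(1)] by (simp add: comp_def)
  have [measurable]: "h n \<in> borel_measurable \<nu>" "H \<in> borel_measurable \<nu>" for n
    using h by (auto intro: L2_functions_measurable)
  have d_lim: "(\<lambda>n. sqn (density \<nu> \<Phi>) (\<lambda>x. h (r n) x - H x)) \<longlonglongrightarrow> 0"
  proof (rule sqn_tendsto_0_transfer[OF _ _ _ _ r_lim, where c = b])
    show "AE x in density \<nu> \<Phi>. (\<lambda>n. h (r n) x) \<longlonglongrightarrow> H x"
      using r(2) by (subst AE_density) auto
  qed (use diff in auto)
  show "sqn (density \<nu> \<Phi>) H \<le> ennreal b * sqn \<nu> H"
    by (rule sqn_limit_le[OF _ _ _ _ d_lim r_lim]) (use upper in auto)
  \<comment> \<open>The lower bound is divided by \<open>a\<close> so that it takes the form of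
    \<open>sqn_limit_le\<close> with the two measures exchanged.\<close>
  have "sqn \<nu> H \<le> ennreal (1/a) * sqn (density \<nu> \<Phi>) H"
  proof (rule sqn_limit_le[OF _ _ _ _ r_lim d_lim])
    fix n
    have "sqn \<nu> (h (r n)) = ennreal (1/a) * (ennreal a * sqn \<nu> (h (r n)))"
      using a by (simp flip: ennreal_mult mult.assoc)
    also have "\<dots> \<le> ennreal (1/a) * sqn (density \<nu> \<Phi>) (h (r n))"
      by (intro mult_left_mono lower) auto
    finally show "sqn \<nu> (h (r n)) \<le> ennreal (1/a) * sqn (density \<nu> \<Phi>) (h (r n))" .
  qed auto
  then have "ennreal a * sqn \<nu> H \<le> ennreal a * (ennreal (1/a) * sqn (density \<nu> \<Phi>) H)"
    by (rule mult_left_mono) simp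
  also have "\<dots> = sqn (density \<nu> \<Phi>) H"
    using a by (simp flip: ennreal_mult mult.assoc)
  finally show "ennreal a * sqn \<nu> H \<le> sqn (density \<nu> \<Phi>) H" .
qed

text \<open>Each bound is tested on the part of a set of finite measure where it fails. There the
  integral of the excess or deficit must vanish although the integrand is positive, so that part is
  a null set.\<close>

lemma AE_bounds_of_set_integrals:
  fixes \<Phi> :: "'x \<Rightarrow> ennreal"
  assumes "sigma_finite_measure \<nu>" and [measurable]: "\<Phi> \<in> borel_measurable \<nu>"
    and bounds: "\<And>S. S \<in> sets \<nu> \<Longrightarrow> emeasure \<nu> S < \<infinity> \<Longrightarrow>
      ennreal a * emeasure \<nu> S \<le> (\<integral>\<^sup>+x. \<Phi> x * indicator S x \<partial>\<nu>) \<and>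
      (\<integral>\<^sup>+x. \<Phi> x * indicator S x \<partial>\<nu>) \<le> ennreal b * emeasure \<nu> S"
  shows "AE x in \<nu>. ennreal a \<le> \<Phi> x \<and> \<Phi> x \<le> ennreal b"
proof -
  interpret sigma_finite_measure \<nu> by fact
  obtain F :: "nat \<Rightarrow> 'x set" where F: "range F \<subseteq> sets \<nu>" "(\<Union>i. F i) = space \<nu>"
      "\<And>i. emeasure \<nu> (F i) \<noteq> \<infinity>"
    using sigma_finite by blast
  have [measurable]: "F i \<in> sets \<nu>" for i using F by auto
  have "AE x in \<nu>. x \<in> F i \<longrightarrow> \<Phi> x \<le> ennreal b" for i
  proof -
    define S where "S = {x \<in> space \<nu>. x \<in> F i \<and> ennreal b < \<Phi> x}"
    have S[measurable]: "S \<in> sets \<nu>" unfolding S_def by measurable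
    have "emeasure \<nu> S \<le> emeasure \<nu> (F i)"
      by (rule emeasure_mono) (auto simp: S_def)
    then have fin: "emeasure \<nu> S < \<infinity>"
      using F(3)[of i] by (auto simp: top.not_eq_extremum intro: le_less_trans)
    \<comment> \<open>Subtraction in \<open>ennreal\<close> is truncated, so the excess is added
      back instead; on \<open>S\<close> this recovers \<open>\<Phi>\<close> even where it is
      infinite. Finiteness of \<open>emeasure \<nu> S\<close> then permits cancellation.\<close>
    have "(\<integral>\<^sup>+x. (\<Phi> x - ennreal b) * indicator S x \<partial>\<nu>) + ennreal b * emeasure \<nu> S =
        (\<integral>\<^sup>+x. (\<Phi> x - ennreal b) * indicator S x + ennreal b * indicator S x \<partial>\<nu>)"
      by (subst nn_integral_add) (auto simp: nn_integral_cmult_indicator)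
    also have "\<dots> = (\<integral>\<^sup>+x. \<Phi> x * indicator S x \<partial>\<nu>)"
      by (intro nn_integral_cong) (auto simp: S_def diff_add_cancel_ennreal split: split_indicator)
    also have "\<dots> \<le> 0 + ennreal b * emeasure \<nu> S"
      using bounds[OF S fin] by simp
    finally have "(\<integral>\<^sup>+x. (\<Phi> x - ennreal b) * indicator S x \<partial>\<nu>) \<le> 0"
      using fin by (subst (asm) (1 2) add.commute, subst (asm) ennreal_add_left_cancel_le) (auto simp: ennreal_mult_eq_top_iff)
    then have "AE x in \<nu>. (\<Phi> x - ennreal b) * indicator S x = 0"
      by (subst nn_integral_0_iff_AE[symmetric]) auto
    then show ?thesis
      using AE_space by eventually_elim (auto simp: S_def diff_eq_0_iff_ennreal not_le split: split_indicator_asm)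
  qed
  then have upper: "AE x in \<nu>. \<forall>i. x \<in> F i \<longrightarrow> \<Phi> x \<le> ennreal b"
    unfolding AE_all_countable by (rule allI)
  have "AE x in \<nu>. x \<in> F i \<longrightarrow> ennreal a \<le> \<Phi> x" for i
  proof -
    define S where "S = {x \<in> space \<nu>. x \<in> F i \<and> \<Phi> x < ennreal a}"
    have S[measurable]: "S \<in> sets \<nu>" unfolding S_def by measurable
    have "emeasure \<nu> S \<le> emeasure \<nu> (F i)"
      by (rule emeasure_mono) (auto simp: S_def)
    then have fin: "emeasure \<nu> S < \<infinity>"
      using F(3)[of i] by (auto simp: top.not_eq_extremum intro: le_less_trans)
    have "(\<integral>\<^sup>+x. (ennreal a - \<Phi> x) * indicator S x \<partial>\<nu>) + (\<integral>\<^sup>+x. \<Phi> x * indicator S x \<partial>\<nu>) =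
        (\<integral>\<^sup>+x. (ennreal a - \<Phi> x) * indicator S x + \<Phi> x * indicator S x \<partial>\<nu>)"
      by (subst nn_integral_add) auto
    also have "\<dots> = (\<integral>\<^sup>+x. ennreal a * indicator S x \<partial>\<nu>)"
      by (intro nn_integral_cong) (auto simp: S_def diff_add_cancel_ennreal split: split_indicator)
    also have "\<dots> \<le> 0 + (\<integral>\<^sup>+x. \<Phi> x * indicator S x \<partial>\<nu>)"
      using bounds[OF S fin] by (simp add: nn_integral_cmult_indicator)
    \<comment> \<open>The term to be cancelled is now an integral of \<open>\<Phi>\<close>; its
      finiteness comes from the upper bound on \<open>S\<close>.\<close>
    finally have "(\<integral>\<^sup>+x. (ennreal a - \<Phi> x) * indicator S x \<partial>\<nu>) \<le> 0"
      using fin bounds[OF S fin]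
      by (subst (asm) (1 2) add.commute, subst (asm) ennreal_add_left_cancel_le) (auto simp: ennreal_mult_eq_top_iff top_unique)
    then have "AE x in \<nu>. (ennreal a - \<Phi> x) * indicator S x = 0"
      by (subst nn_integral_0_iff_AE[symmetric]) auto
    then show ?thesis
      using AE_space by eventually_elim (auto simp: S_def diff_eq_0_iff_ennreal not_le split: split_indicator_asm)
  qed
  then have lower: "AE x in \<nu>. \<forall>i. x \<in> F i \<longrightarrow> ennreal a \<le> \<Phi> x"
    unfolding AE_all_countable by (rule allI)
  show ?thesis
    using upper lower AE_space
  proof eventually_elim
    case (elim x)
    then obtain i where "x \<in> F i" using F(2) by blast
    with elim show ?case by blast
  qed
qed

section \<open>Haar measure and averaging over a quotient\<close>

lemma group_measurable_uminus [measurable (raw)]: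
  fixes f :: "'x \<Rightarrow> 'b::{second_countable_topology, topological_ab_group_add}"
  assumes "f \<in> borel_measurable M"
  shows "(\<lambda>x. - f x) \<in> borel_measurable M"
  by (rule borel_measurable_continuous_on[OF _ assms]) (intro continuous_intros)

lemma group_measurable_diff [measurable (raw)]:
  fixes f :: "'x \<Rightarrow> 'b::{second_countable_topology, topological_ab_group_add}"
  assumes [measurable]: "f \<in> borel_measurable M" "g \<in> borel_measurable M"
  shows "(\<lambda>x. f x - g x) \<in> borel_measurable M"
proof -
  have "(\<lambda>x. f x + - g x) \<in> borel_measurable M" by measurable
  then show ?thesis by simp
qed

lemma locally_compactE:
  fixes x :: "'a::topological_space"
  assumes "locally_compact_space (euclidean :: 'a topology)"
  obtains U K where "open U" "compact K" "x \<in> U" "U \<subseteq> K"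
proof -
  have "\<exists>U K. open U \<and> compact K \<and> x \<in> U \<and> U \<subseteq> K"
    using assms by (simp add: locally_compact_space_def)
  then show ?thesis
    using that by blast
qed

lemma additive_subgroup_diff:
  "additive_subgroup L \<Longrightarrow> x \<in> L \<Longrightarrow> y \<in> L \<Longrightarrow> x - y \<in> L"
  unfolding additive_subgroup_def by (metis add_uminus_conv_diff)

lemma haar_sets_closed:
  assumes "closed L" "haar_measure (top_of_set L) add M"
  shows "sets M = sets (restrict_space borel L)" "space M = L"
proof -
  have "sets (restrict_space borel L) = (\<inter>) L ` sigma_sets UNIV {S. open S}"
    by (simp add: sets_restrict_space borel_def sets_measure_of)
  also have "\<dots> = sigma_sets L ((\<inter>) L ` {S. open S})"
    using borel_closed[OF assms(1)] by (intro sigma_sets_Int) (simp_all add: borel_def sets_measure_of)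
  also have "(\<inter>) L ` {S. open S} = {U. openin (top_of_set L) U}"
    by (auto simp: openin_open)
  finally show "sets M = sets (restrict_space borel L)"
    using assms(2) by (simp add: haar_measure_def)
  show "space M = L"
    using assms(2) by (simp add: haar_measure_def)
qed

lemma haar_sets:
  assumes "haar_measure euclidean add M"
  shows "sets M = sets borel" "space M = UNIV"
  using haar_sets_closed[of UNIV add M] assms by simp_all

text \<open>By local compactness every point lies in a basic open set contained in a compact set.
  Countably many such basic sets, intersected with \<open>L\<close>, have finite measure and cover
  \<open>L\<close>.\<close>

lemma haar_sigma_finite:
  fixes L :: "'a::{second_countable_topology, t2_space} set"
  assumes lc: "locally_compact_space (euclidean :: 'a topology)" and L: "closed L"
    and M: "haar_measure (top_of_set L) add M"
  shows "sigma_finite_measure M"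
proof -
  note sets = haar_sets_closed[OF L M]
  obtain B :: "'a set set" where B: "countable B" "topological_basis B"
    using ex_countable_basis by blast
  define \<A> where "\<A> = (\<lambda>b. b \<inter> L) ` {b \<in> B. emeasure M (b \<inter> L) < \<infinity>}"
  have "x \<in> \<Union>\<A>" if x: "x \<in> L" for x
  proof -
    obtain U K where U: "open U" "compact K" "x \<in> U" "U \<subseteq> K"
      using locally_compactE[OF lc] .
    obtain b where b: "b \<in> B" "x \<in> b" "b \<subseteq> U"
      using topological_basisE[OF B(2) U(1,3)] by blast
    have "emeasure M (b \<inter> L) \<le> emeasure M (K \<inter> L)"
      using b U L by (intro emeasure_mono) (auto simp: sets sets_restrict_space compact_imp_closed)
    also have "\<dots> < \<infinity>"
      using M U L by (auto simp: haar_measure_def compactin_subtopology compact_Int_closed)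
    finally show ?thesis
      using b x by (auto simp: \<A>_def)
  qed
  moreover have "countable \<A>"
    using B(1) by (simp add: \<A>_def)
  moreover have "\<A> \<subseteq> sets M"
    using topological_basis_open[OF B(2)] by (auto simp: \<A>_def sets sets_restrict_space)
  moreover have "\<Union>\<A> \<subseteq> space M"
    by (auto simp: \<A>_def sets)
  moreover have "\<forall>a\<in>\<A>. emeasure M a \<noteq> \<infinity>"
    by (auto simp: \<A>_def)
  ultimately show ?thesis
    unfolding sigma_finite_measure_def sets(2) by blast
qed

text \<open>Measurability of the translation is a hypothesis, not a consequence of the type class.
  Thus the lemma serves both the group and its dual, which has no topological group instance
  here.\<close>

lemma haar_distr:
  fixes M :: "'b::{topological_space, ab_group_add} measure"
  assumes M: "haar_measure euclidean (+) M" and y: "(\<lambda>x. y + x) \<in> borel_measurable borel"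
  shows "distr M borel (\<lambda>x. y + x) = M"
proof (rule measure_eqI)
  note [measurable_cong] = haar_sets(1)[OF M]
  show "sets (distr M borel (\<lambda>x. y + x)) = sets M"
    by (simp add: haar_sets[OF M])
  fix X assume X: "X \<in> sets (distr M borel (\<lambda>x. y + x))"
  have "emeasure (distr M borel (\<lambda>x. y + x)) X = emeasure M ((\<lambda>x. y + x) -` X)"
    using X y by (subst emeasure_distr) (auto simp: haar_sets[OF M] cong: measurable_cong_sets)
  also have "(\<lambda>x. y + x) -` X = (+) (- y) ` X"
    by (force simp: image_iff algebra_simps)
  also have "emeasure M \<dots> = emeasure M X"
  proof -
    have "\<forall>A\<in>sets M. emeasure M ((+) (- y) ` A) = emeasure M A"
      using M unfolding haar_measure_def topspace_euclidean by blast
    moreover have "X \<in> sets M"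
      using X by (simp add: haar_sets(1)[OF M])
    ultimately show ?thesis by (rule bspec)
  qed
  finally show "emeasure (distr M borel (\<lambda>x. y + x)) X = emeasure M X" .
qed

lemma haar_nn_integral_translate:
  fixes M :: "'b::{topological_space, ab_group_add} measure"
  assumes M: "haar_measure euclidean (+) M" and y: "(\<lambda>x. y + x) \<in> borel_measurable borel"
    and f: "f \<in> borel_measurable borel"
  shows "(\<integral>\<^sup>+x. f (y + x) \<partial>M) = (\<integral>\<^sup>+x. f x \<partial>M)"
proof -
  have "(\<integral>\<^sup>+x. f x \<partial>distr M borel (\<lambda>x. y + x)) = (\<integral>\<^sup>+x. f (y + x) \<partial>M)"
    using y f by (subst nn_integral_distr) (auto simp: haar_sets[OF M] cong: measurable_cong_sets)
  then show ?thesis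
    by (simp add: haar_distr[OF M y])
qed

lemma haar_integral_translate:
  fixes M :: "'b::{topological_space, ab_group_add} measure"
    and f :: "'b \<Rightarrow> complex"
  assumes M: "haar_measure euclidean (+) M" and y: "(\<lambda>x. y + x) \<in> borel_measurable borel"
    and f: "f \<in> borel_measurable borel"
  shows "(LINT x|M. f (y + x)) = (LINT x|M. f x)"
proof -
  have "(LINT x|distr M borel (\<lambda>x. y + x). f x) = (LINT x|M. f (y + x))"
    using y f by (subst integral_distr) (auto simp: haar_sets[OF M] cong: measurable_cong_sets)
  then show ?thesis
    by (simp add: haar_distr[OF M y])
qed

text \<open>Both sides, multiplied by the mass of a relatively compact open set \<open>U\<close>, are equal
  to the double integral of \<open>indicator U x * k (y - x)\<close>.\<close>

lemma haar_nn_integral_minus: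
  fixes M :: "'a::{topological_ab_group_add, second_countable_topology, t2_space} measure"
  assumes lc: "locally_compact_space (euclidean :: 'a topology)" 
    and M: "haar_measure euclidean (+) M"
    and k[measurable]: "k \<in> borel_measurable borel"
  shows "(\<integral>\<^sup>+x. k (- x) \<partial>M) = (\<integral>\<^sup>+x. k x \<partial>M)"
proof -
  note [measurable_cong] = haar_sets(1)[OF M]
  interpret sigma_finite_measure M
    using haar_sigma_finite[of UNIV "(+)" M] lc M by simp
  interpret pair_sigma_finite M M ..
  have tr: "(\<lambda>x. y + x) \<in> borel_measurable borel" for y :: 'a by measurable
  note shift = haar_nn_integral_translate[OF M tr]
  obtain U K where U: "open U" "compact K" "(0::'a) \<in> U" "U \<subseteq> K"
    using locally_compactE[OF lc] .
  let ?f = "indicator U :: 'a \<Rightarrow> ennreal"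
  have [measurable]: "U \<in> sets borel" using U by simp
  let ?I = "\<integral>\<^sup>+x. ?f x \<partial>M"
  have I: "?I = emeasure M U" by (simp add: haar_sets[OF M])
  have pos: "?I > 0"
    using M U by (auto simp: I haar_measure_def)
  have "?I \<le> emeasure M K"
    unfolding I using U by (intro emeasure_mono) (auto simp: haar_sets[OF M] compact_imp_closed)
  also have "\<dots> < \<infinity>"
    using M U by (auto simp: haar_measure_def)
  finally have fin: "?I < \<infinity>" .
  have "?I * (\<integral>\<^sup>+y. k y \<partial>M) = (\<integral>\<^sup>+x. ?f x * (\<integral>\<^sup>+y. k y \<partial>M) \<partial>M)"
    by (simp add: nn_integral_multc)
  also have "\<dots> = (\<integral>\<^sup>+x. ?f x * (\<integral>\<^sup>+y. k (- x + y) \<partial>M) \<partial>M)"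
    by (subst shift) auto
  also have "\<dots> = (\<integral>\<^sup>+x. (\<integral>\<^sup>+y. ?f x * k (- x + y) \<partial>M) \<partial>M)"
    by (subst nn_integral_cmult) auto
  also have "\<dots> = (\<integral>\<^sup>+y. (\<integral>\<^sup>+x. ?f x * k (- x + y) \<partial>M) \<partial>M)"
    by (rule Fubini') measurable
  \<comment> \<open>For fixed \<open>y\<close>, shifting \<open>x\<close> by \<open>y\<close> turns
    \<open>k (- x + y)\<close> into \<open>k (- x)\<close> and leaves \<open>y\<close> only in the
    indicator, whose integral over \<open>y\<close> is again the mass of \<open>U\<close>.\<close>
  also have "\<dots> = (\<integral>\<^sup>+y. (\<integral>\<^sup>+x. ?f (y + x) * k (- (y + x) + y) \<partial>M) \<partial>M)"
    by (subst shift[of "\<lambda>x. ?f x * k (- x + _)"]) auto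
  also have "\<dots> = (\<integral>\<^sup>+y. (\<integral>\<^sup>+x. ?f (x + y) * k (- x) \<partial>M) \<partial>M)"
    by (simp add: algebra_simps)
  also have "\<dots> = (\<integral>\<^sup>+x. (\<integral>\<^sup>+y. ?f (x + y) * k (- x) \<partial>M) \<partial>M)"
    by (rule Fubini') measurable
  also have "\<dots> = (\<integral>\<^sup>+x. (\<integral>\<^sup>+y. ?f (x + y) \<partial>M) * k (- x) \<partial>M)"
    by (subst nn_integral_multc) auto
  also have "\<dots> = (\<integral>\<^sup>+x. ?I * k (- x) \<partial>M)"
    by (subst shift) auto
  also have "\<dots> = ?I * (\<integral>\<^sup>+x. k (- x) \<partial>M)"
    by (rule nn_integral_cmult) measurable
  finally show ?thesis
    using pos fin by (auto simp: ennreal_mult_cancel_left)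
qed

section \<open>Cosets of a closed cocompact subgroup\<close>

lemma coset_eqD:
  assumes "additive_subgroup L" "x +o L = y +o L"
  shows "\<exists>q\<in>L. y = x + q"
proof -
  have "y \<in> y +o L"
    using assms(1) set_zero_plus2 by (force simp: additive_subgroup_def elt_set_plus_def)
  then show ?thesis
    using assms(2) by (auto simp: elt_set_plus_def)
qed

text \<open>The saturation of \<open>U\<close> is the union of its translates by elements of
  \<open>L\<close>, and translates of open sets are open.\<close>

lemma openin_quotient_image:
  fixes U :: "'a::topological_ab_group_add set"
  assumes L: "additive_subgroup L" and U: "open U"
  shows "openin (quotient_topology L) ((\<lambda>x. x +o L) ` U)"
proof -
  have "(\<lambda>x. x +o L) -` ((\<lambda>x. x +o L) ` U) = (\<Union>q\<in>L. (\<lambda>x. x + q) -` U)"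
  proof (intro set_eqI iffI)
    fix x assume "x \<in> (\<lambda>x. x +o L) -` ((\<lambda>x. x +o L) ` U)"
    then obtain u where "u \<in> U" "x +o L = u +o L" by auto
    then show "x \<in> (\<Union>q\<in>L. (\<lambda>x. x + q) -` U)"
      using coset_eqD[OF L, of x u] by auto
  next
    fix x assume "x \<in> (\<Union>q\<in>L. (\<lambda>x. x + q) -` U)"
    then obtain q where q: "q \<in> L" "x + q \<in> U" by auto
    have "x +o L = (x + q) +o L"
    proof (intro set_eqI iffI)
      fix z assume "z \<in> x +o L"
      then obtain l where "l \<in> L" "z = x + l" by (auto simp: elt_set_plus_def)
      then show "z \<in> (x + q) +o L"
        using additive_subgroup_diff[OF L _ q(1)]
        unfolding elt_set_plus_def by (intro CollectI bexI[of _ "l - q"]) auto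
    next
      fix z assume "z \<in> (x + q) +o L"
      then show "z \<in> x +o L"
        using L q by (auto simp: elt_set_plus_def additive_subgroup_def add.assoc)
    qed
    then show "x \<in> (\<lambda>x. x +o L) -` ((\<lambda>x. x +o L) ` U)"
      using q by auto
  qed
  moreover have "open ((\<lambda>x. x + q) -` U)" for q
    using U by (intro open_vimage continuous_intros)
  ultimately show ?thesis
    by (auto simp: openin_quotient_topology)
qed

text \<open>The images of relatively compact open neighbourhoods form an open cover of the compact
  quotient; the union of finitely many neighbourhoods whose images suffice is the required
  set.\<close>

lemma relatively_compact_meets_cosets:
  fixes L :: "'a::topological_ab_group_add set"
  assumes lc: "locally_compact_space (euclidean :: 'a topology)"
    and L: "additive_subgroup L" and cocompact: "compact_space (quotient_topology L)"
  obtains V K where "open V" "compact K" "V \<subseteq> K" "\<And>y. \<exists>q\<in>L. y + q \<in> V"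
proof -
  have "\<forall>x::'a. \<exists>U K. open U \<and> compact K \<and> x \<in> U \<and> U \<subseteq> K"
    using locally_compactE[OF lc] by metis
  then obtain U K where UK: "\<And>x::'a. open (U x)" "\<And>x. compact (K x)" "\<And>x. x \<in> U x" "\<And>x. U x \<subseteq> K x"
    by metis
  let ?W = "\<lambda>x. (\<lambda>y. y +o L) ` U x"
  have cover: "(\<forall>W\<in>range ?W. openin (quotient_topology L) W) \<and> topspace (quotient_topology L) \<subseteq> \<Union>(range ?W)"
    using UK by (auto simp: topspace_quotient_topology intro!: openin_quotient_image[OF L])
  have "\<exists>\<F>. finite \<F> \<and> \<F> \<subseteq> range ?W \<and> topspace (quotient_topology L) \<subseteq> \<Union>\<F>"
    using cocompact[unfolded compact_space_def compactin_def, THEN conjunct2, THEN spec, THEN mp, OF cover] .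
  then obtain \<F> where F: "finite \<F>" "\<F> \<subseteq> range ?W" "topspace (quotient_topology L) \<subseteq> \<Union>\<F>"
    by (elim exE conjE)
  obtain F where F': "finite F" "\<F> = ?W ` F"
    using finite_subset_image[OF F(1,2)] by auto
  show ?thesis
  proof (rule that[of "\<Union>(U ` F)" "\<Union>(K ` F)"])
    fix y :: 'a
    have "y +o L \<in> \<Union>(?W ` F)"
      using F(3) unfolding F'(2) topspace_quotient_topology by (rule subsetD) (rule rangeI)
    then obtain x v where v: "x \<in> F" "v \<in> U x" "y +o L = v +o L" by auto
    obtain q where "q \<in> L" "v = y + q"
      using coset_eqD[OF L v(3)] by blast
    then show "\<exists>q\<in>L. y + q \<in> \<Union>(U ` F)"
      using v by auto
  qed (use UK F' in \<open>auto intro: subsetD[OF UK(4)]\<close>)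
qed

text \<open>The witness is the indicator of a relatively compact set meeting every coset, divided by its
  own periodization. It replaces integrals over the quotient, so that measurability of functions
  on the quotient never has to be discussed.\<close>

lemma bruhat_function:
  fixes L :: "'a::{topological_ab_group_add, t2_space, second_countable_topology} set"
  assumes lc: "locally_compact_space (euclidean :: 'a topology)"
    and L: "additive_subgroup L" "closed L" "compact_space (quotient_topology L)"
    and m: "haar_measure (top_of_set L) (+) m"
  obtains \<theta> :: "'a \<Rightarrow> ennreal"
  where "\<theta> \<in> borel_measurable borel" "\<And>y. (\<integral>\<^sup>+q. \<theta> (y + q) \<partial>m) = 1"
proof -
  note sets = haar_sets_closed[OF L(2) m]
  interpret sigma_finite_measure m
    by (rule haar_sigma_finite[OF lc L(2) m])
  have [measurable]: "(\<lambda>q. q) \<in> borel_measurable m"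
    by (auto simp: measurable_def sets sets_restrict_space)
  obtain V K where V: "open V" "compact K" "V \<subseteq> K" "\<And>y. \<exists>q\<in>L. y + q \<in> V"
    using relatively_compact_meets_cosets[OF lc L(1,3)] by blast
  have [measurable]: "V \<in> sets borel" using V by simp
  define T where "T y = (\<integral>\<^sup>+q. indicator V (y + q) \<partial>m)" for y
  have [measurable]: "T \<in> borel_measurable borel"
    unfolding T_def by measurable
  have T: "T y = emeasure m {q\<in>L. y + q \<in> V}" for y
  proof -
    have "{q\<in>space m. y + q \<in> V} \<in> sets m" by measurable
    moreover have "T y = (\<integral>\<^sup>+q. indicator {q\<in>space m. y + q \<in> V} q \<partial>m)"
      unfolding T_def by (intro nn_integral_cong) (simp add: indicator_def)
    ultimately show ?thesis
      by (simp add: sets)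
  qed
  have opn: "openin (top_of_set L) {q\<in>L. y + q \<in> V}" for y
  proof -
    have "open ((\<lambda>q. y + q) -` V)"
      using V by (intro open_vimage continuous_intros)
    moreover have "{q\<in>L. y + q \<in> V} = L \<inter> (\<lambda>q. y + q) -` V" by auto
    ultimately show ?thesis by (auto simp: openin_open)
  qed
  \<comment> \<open>Openness of \<open>V\<close> makes the periodization \<open>T\<close> positive,
    and containment of \<open>V\<close> in the compact set \<open>K\<close> makes it finite, so
    division by it is legitimate.\<close>
  have pos: "T y > 0" for y
  proof -
    have "{q\<in>L. y + q \<in> V} \<noteq> {}" using V(4)[of y] by auto
    then show ?thesis
      using m opn[of y] by (auto simp: T haar_measure_def)
  qed
  have fin: "T y < \<infinity>" for y
  proof -
    have "compact ((\<lambda>x. - y + x) ` K)"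
      using V by (intro compact_continuous_image continuous_intros)
    then have c: "compact ((\<lambda>x. - y + x) ` K \<inter> L)"
      using L(2) by (rule compact_Int_closed)
    have "q \<in> (\<lambda>x. - y + x) ` K" if "y + q \<in> V" for q
      using subsetD[OF V(3) that] by (intro image_eqI[of _ _ "y + q"]) auto
    then have "{q\<in>L. y + q \<in> V} \<subseteq> (\<lambda>x. - y + x) ` K \<inter> L"
      by blast
    moreover have "(\<lambda>x. - y + x) ` K \<inter> L \<in> sets m"
      unfolding sets sets_restrict_space using borel_compact[OF c] by (intro image_eqI) auto
    ultimately have "T y \<le> emeasure m ((\<lambda>x. - y + x) ` K \<inter> L)"
      unfolding T by (rule emeasure_mono)
    also have "\<dots> < \<infinity>"
      using m c by (auto simp: haar_measure_def compactin_subtopology)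
    finally show ?thesis .
  qed
  have per: "T (y + q) = T y" if q: "q \<in> L" for y q
  proof -
    have "{l\<in>L. y + l \<in> V} = (+) q ` {l\<in>L. y + q + l \<in> V}"
    proof (intro set_eqI iffI)
      fix l assume "l \<in> {l\<in>L. y + l \<in> V}"
      then show "l \<in> (+) q ` {l\<in>L. y + q + l \<in> V}"
        using additive_subgroup_diff[OF L(1) _ q]
        by (intro image_eqI[of _ _ "l - q"]) (auto simp: add.assoc)
    qed (use L q in \<open>auto simp: additive_subgroup_def add.assoc\<close>)
    moreover have "{l\<in>L. y + q + l \<in> V} \<in> sets m"
      using m opn[of "y + q"] by (auto simp: haar_measure_def)
    ultimately show ?thesis
      using m q by (simp add: T haar_measure_def)
  qed
  show ?thesis
  proof (rule that[of "\<lambda>y. indicator V y / T y"])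
    fix y
    \<comment> \<open>\<open>T\<close> is constant on cosets, so the denominator leaves the integral
      and the numerator integrates to the same \<open>T y\<close>.\<close>
    have "(\<integral>\<^sup>+q. indicator V (y + q) / T (y + q) \<partial>m) = (\<integral>\<^sup>+q. indicator V (y + q) / T y \<partial>m)"
      by (intro nn_integral_cong) (simp add: per sets)
    also have "\<dots> = T y / T y"
      unfolding T_def by (rule nn_integral_divide) measurable
    finally show "(\<integral>\<^sup>+q. indicator V (y + q) / T (y + q) \<partial>m) = 1"
      using pos[of y] fin[of y] by simp
  qed measurable
qed

text \<open>After exchanging the integrals, translation by \<open>q\<close> moves \<open>q\<close>
  from \<open>h\<close> into \<open>\<theta>\<close>, where integration over the subgroup gives 1.
  The argument \<open>- y\<close> is chosen so that the translated weight is
  \<open>\<theta> (- y + q)\<close>, matching the normalization \<open>one\<close> without inverting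
  \<open>q\<close>.\<close>

lemma bruhat_average:
  fixes L :: "'a::{topological_ab_group_add, t2_space, second_countable_topology} set"
  assumes lc: "locally_compact_space (euclidean :: 'a topology)"
    and M: "haar_measure euclidean (+) M"
    and L: "closed L" and m: "haar_measure (top_of_set L) (+) m"
    and \<theta>[measurable]: "\<theta> \<in> borel_measurable borel" and h[measurable]: "h \<in> borel_measurable borel"
    and one: "\<And>y. (\<integral>\<^sup>+q. \<theta> (y + q) \<partial>m) = 1"
  shows "(\<integral>\<^sup>+y. \<theta> (- y) * (\<integral>\<^sup>+q. h (y + q) \<partial>m) \<partial>M) = (\<integral>\<^sup>+y. h y \<partial>M)"
proof -
  note sets = haar_sets_closed[OF L m]
  note [measurable_cong] = haar_sets(1)[OF M]
  interpret m: sigma_finite_measure m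
    by (rule haar_sigma_finite[OF lc L m])
  interpret M: sigma_finite_measure M
    using haar_sigma_finite[of UNIV "(+)" M] lc M by simp
  interpret pair_sigma_finite M m ..
  interpret mM: pair_sigma_finite m M ..
  have [measurable]: "(\<lambda>q. q) \<in> borel_measurable m"
    by (auto simp: measurable_def sets sets_restrict_space)
  have tr: "(\<lambda>x. y + x) \<in> borel_measurable borel" for y :: 'a by measurable
  have "(\<integral>\<^sup>+y. \<theta> (- y) * (\<integral>\<^sup>+q. h (y + q) \<partial>m) \<partial>M) =
      (\<integral>\<^sup>+y. (\<integral>\<^sup>+q. \<theta> (- y) * h (y + q) \<partial>m) \<partial>M)"
    by (subst nn_integral_cmult) auto
  also have "\<dots> = (\<integral>\<^sup>+q. (\<integral>\<^sup>+y. \<theta> (- y) * h (y + q) \<partial>M) \<partial>m)"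
    by (rule mM.Fubini') measurable
  also have "\<dots> = (\<integral>\<^sup>+q. (\<integral>\<^sup>+y. \<theta> (- y + q) * h y \<partial>M) \<partial>m)"
  proof (rule nn_integral_cong)
    fix q
    have "(\<integral>\<^sup>+y. \<theta> (- (q + y) + q) * h (q + y) \<partial>M) = (\<integral>\<^sup>+y. \<theta> (- y + q) * h y \<partial>M)"
      by (rule haar_nn_integral_translate[OF M tr, of "\<lambda>y. \<theta> (- y + q) * h y"]) measurable
    then show "(\<integral>\<^sup>+y. \<theta> (- y) * h (y + q) \<partial>M) = (\<integral>\<^sup>+y. \<theta> (- y + q) * h y \<partial>M)"
      by (simp add: add.commute)
  qed
  also have "\<dots> = (\<integral>\<^sup>+y. (\<integral>\<^sup>+q. \<theta> (- y + q) * h y \<partial>m) \<partial>M)"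
    by (rule Fubini') measurable
  also have "\<dots> = (\<integral>\<^sup>+y. (\<integral>\<^sup>+q. \<theta> (- y + q) \<partial>m) * h y \<partial>M)"
    by (subst nn_integral_multc) auto
  finally show ?thesis
    by (simp only: one mult_1_left)
qed

section \<open>Plancherel's theorem for correlations\<close>

lemma borel_measurable_cnj [measurable (raw)]:
  "f \<in> borel_measurable M \<Longrightarrow> (\<lambda>x. cnj (f x)) \<in> borel_measurable M"
  by (rule borel_measurable_continuous_on[where f=cnj]) (auto intro: continuous_intros)

lemma continuous_on_pairing: "continuous_on UNIV (pairing p)"
  and cmod_pairing [simp]: "cmod (pairing p x) = 1"
  and pairing_add: "pairing p (x + y) = pairing p x * pairing p y"
  using pairing[of p] by auto

lemma borel_measurable_pairing: "pairing p \<in> borel_measurable borel"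
  by (intro borel_measurable_continuous_onI continuous_on_pairing)

lemma pairing_mult_cnj [simp]: "pairing p x * cnj (pairing p x) = 1"
  by (simp flip: complex_norm_square)

section \<open>The Fourier transform of integrable functions and its extension\<close>

lemma integrable_fourier:
  assumes "f \<in> L1_functions \<mu>" "sets \<mu> = sets borel"
  shows "integrable \<mu> (\<lambda>x. f x * cnj (pairing \<xi> x))"
proof (rule Bochner_Integration.integrable_bound)
  note [measurable] = borel_measurable_pairing
  note [measurable_cong] = assms(2)
  show f: "integrable \<mu> f" using assms by (simp add: L1_functions_def)
  have [measurable]: "f \<in> borel_measurable \<mu>" using f by simp
  show "(\<lambda>x. f x * cnj (pairing \<xi> x)) \<in> borel_measurable \<mu>" by measurable
qed (simp add: norm_mult)

lemma fourier_diff: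
  assumes "f \<in> L1_functions \<mu>" "h \<in> L1_functions \<mu>" "sets \<mu> = sets borel"
  shows "fourier \<mu> (\<lambda>x. f x - h x) = (\<lambda>\<xi>. fourier \<mu> f \<xi> - fourier \<mu> h \<xi>)"
  unfolding fourier_def left_diff_distrib
  by (intro ext Bochner_Integration.integral_diff integrable_fourier assms)

lemma cmod_fourier_le: "cmod (fourier \<mu> f \<xi>) \<le> (LINT x|\<mu>. cmod (f x))"
  unfolding fourier_def
  using integral_norm_bound[of \<mu> "\<lambda>x. f x * cnj (pairing \<xi> x)"] by (simp add: norm_mult)

lemma fourier_unitary_L2:
  assumes "fourier_unitary \<mu> \<nu>" "f \<in> L1_functions \<mu> \<inter> L2_functions \<mu>"
  shows "fourier \<mu> f \<in> L2_functions \<nu>"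
  using assms by (auto simp: fourier_unitary_def)

lemma fourier_unitary_sqn:
  assumes "fourier_unitary \<mu> \<nu>" "f \<in> L1_functions \<mu> \<inter> L2_functions \<mu>"
  shows "sqn \<nu> (fourier \<mu> f) = sqn \<mu> f"
proof -
  have "fourier \<mu> f \<in> L2_functions \<nu>" "L2_norm \<nu> (fourier \<mu> f) = L2_norm \<mu> f"
    using assms unfolding fourier_unitary_def by blast+
  then show ?thesis
    using assms(2) by (simp add: sqn_eq_L2_norm)
qed

lemma L1_L2_functions_diff:
  assumes "f \<in> L1_functions \<mu> \<inter> L2_functions \<mu>" "h \<in> L1_functions \<mu> \<inter> L2_functions \<mu>"
  shows "(\<lambda>x. f x - h x) \<in> L1_functions \<mu> \<inter> L2_functions \<mu>"
  using assms by (auto intro: L2_functions_diff simp: L1_functions_def)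

lemma is_fourier_L2_iff_sqn:
  assumes g: "g \<in> L2_functions \<mu>"
  shows "is_fourier_L2 \<mu> \<nu> g G \<longleftrightarrow> G \<in> L2_functions \<nu> \<and>
     (\<exists>f :: nat \<Rightarrow> 'a::topological_ab_group_add \<Rightarrow> complex.
        (\<forall>n. f n \<in> L1_functions \<mu> \<inter> L2_functions \<mu> \<and> fourier \<mu> (f n) \<in> L2_functions \<nu>) \<and>
        (\<lambda>n. sqn \<mu> (\<lambda>x. f n x - g x)) \<longlonglongrightarrow> 0 \<and>
        (\<lambda>n. sqn \<nu> (\<lambda>\<xi>. fourier \<mu> (f n) \<xi> - G \<xi>)) \<longlonglongrightarrow> 0)"
  unfolding is_fourier_L2_def
  by (intro conj_cong refl ex_cong1 L2_norm_tendsto_0_iff) (use g in \<open>auto intro: L2_functions_diff\<close>)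

text \<open>Shows that the choice in \<open>fourier_L2\<close> has a witness: approximants of
  \<open>g\<close> have a Cauchy sequence of transforms by isometry, and completeness supplies its
  limit.\<close>

lemma is_fourier_fourier_L2:
  assumes \<mu>: "sets \<mu> = sets borel" and unitary: "fourier_unitary \<mu> \<nu>" and g: "g \<in> L2_functions \<mu>"
  shows "is_fourier_L2 \<mu> \<nu> g (fourier_L2 \<mu> \<nu> g)"
proof -
  \<comment> \<open>The exponent \<open>Suc n\<close> absorbs the factor \<open>2 + 2\<close> from
    \<open>sqn_diff_le\<close>, leaving the rate \<open>(1/4) ^ n\<close> that
    \<open>L2_complete\<close> demands.\<close>
  have "\<exists>h. h \<in> L1_functions \<mu> \<inter> L2_functions \<mu> \<and> sqn \<mu> (\<lambda>x. h x - g x) \<le> ennreal ((1/4) ^ Suc n)" for n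
    using L1_L2_dense[OF g, of "(1/4) ^ Suc n"] by force
  then obtain f where f: "\<And>n. f n \<in> L1_functions \<mu> \<inter> L2_functions \<mu>"
    and close: "\<And>n. sqn \<mu> (\<lambda>x. f n x - g x) \<le> ennreal ((1/4) ^ Suc n)"
    by metis
  have F: "fourier \<mu> (f n) \<in> L2_functions \<nu>" for n
    by (rule fourier_unitary_L2[OF unitary f])
  have cauchy: "sqn \<nu> (\<lambda>\<xi>. fourier \<mu> (f m) \<xi> - fourier \<mu> (f n) \<xi>) \<le> ennreal ((1/4) ^ n)"
    if "n \<le> m" for n m
  proof -
    have "sqn \<nu> (\<lambda>\<xi>. fourier \<mu> (f m) \<xi> - fourier \<mu> (f n) \<xi>) = sqn \<nu> (fourier \<mu> (\<lambda>x. f m x - f n x))"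
      using f by (simp add: fourier_diff[OF _ _ \<mu>])
    also have "\<dots> = sqn \<mu> (\<lambda>x. f m x - f n x)"
      by (intro fourier_unitary_sqn unitary L1_L2_functions_diff f)
    also have "\<dots> \<le> 2 * sqn \<mu> (\<lambda>x. f m x - g x) + 2 * sqn \<mu> (\<lambda>x. f n x - g x)"
      using f g by (intro sqn_diff_le L2_functions_measurable) auto
    also have "\<dots> \<le> 2 * ennreal ((1/4) ^ Suc n) + 2 * ennreal ((1/4) ^ Suc n)"
    proof (intro add_mono mult_left_mono close)
      show "sqn \<mu> (\<lambda>x. f m x - g x) \<le> ennreal ((1/4) ^ Suc n)"
        using that by (intro order_trans[OF close] ennreal_leI power_decreasing) auto
    qed auto
    also have "\<dots> = ennreal 4 * ennreal ((1/4) ^ Suc n)"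
      by (simp flip: distrib_right)
    also have "\<dots> = ennreal ((1/4) ^ n)"
      by (subst ennreal_mult[symmetric]) auto
    finally show ?thesis .
  qed
  obtain G where "G \<in> L2_functions \<nu>" "(\<lambda>n. sqn \<nu> (\<lambda>\<xi>. fourier \<mu> (f n) \<xi> - G \<xi>)) \<longlonglongrightarrow> 0"
    using L2_complete[OF F cauchy] by blast
  moreover have "(\<lambda>n. sqn \<mu> (\<lambda>x. f n x - g x)) \<longlonglongrightarrow> 0"
  proof (rule tendsto_sandwich[OF _ _ tendsto_const])
    have "(\<lambda>n. ennreal ((1/4) ^ Suc n)) \<longlonglongrightarrow> ennreal 0"
      by (intro tendsto_intros LIMSEQ_Suc LIMSEQ_realpow_zero) auto
    then show "(\<lambda>n. ennreal ((1/4) ^ Suc n)) \<longlonglongrightarrow> 0" by simp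
  qed (use close in auto)
  ultimately have "is_fourier_L2 \<mu> \<nu> g G"
    using f F by (auto simp: is_fourier_L2_iff_sqn[OF g])
  then show ?thesis
    unfolding fourier_L2_def by (rule someI[of "is_fourier_L2 \<mu> \<nu> g"])
qed

section \<open>Correlations of square integrable functions\<close>

locale haar_group =
  fixes \<mu> :: "'a::{topological_ab_group_add, t2_space, second_countable_topology} measure"
  assumes lc: "locally_compact_space (euclidean :: 'a topology)"
    and haar: "haar_measure euclidean (+) \<mu>"
begin

lemma sets_\<mu> [measurable_cong]: "sets \<mu> = sets borel"
  by (rule haar_sets(1)[OF haar])

lemma measurable_translate: "(\<lambda>x. y + x) \<in> borel_measurable borel" for y :: 'a
  by measurable

lemmas nn_integral_translate = haar_nn_integral_translate[OF haar measurable_translate]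
lemmas integral_translate = haar_integral_translate[OF haar measurable_translate]

sublocale sigma_finite_measure \<mu>
  using haar_sigma_finite[of UNIV "(+)" \<mu>] lc haar by simp

sublocale pair: pair_sigma_finite \<mu> \<mu> ..

lemma L2_functions_borel: "f \<in> L2_functions \<mu> \<Longrightarrow> f \<in> borel_measurable borel"
  using L2_functions_measurable[of f \<mu>] measurable_cong_sets[OF sets_\<mu> refl] by blast

lemma sqn_translate:
  assumes [measurable]: "f \<in> borel_measurable borel"
  shows "sqn \<mu> (\<lambda>x. f (y + x)) = sqn \<mu> f"
  unfolding sqn_def by (rule nn_integral_translate) measurable

lemma L2_functions_translate:
  assumes "f \<in> L2_functions \<mu>"
  shows "(\<lambda>x. f (y + x)) \<in> L2_functions \<mu>"
proof -
  note [measurable] = L2_functions_borel[OF assms]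
  show ?thesis
    using assms by (simp add: L2_functions_iff_sqn sqn_translate)
qed

text \<open>The cross-correlation: its value at \<open>x\<close> is the inner product of a translate
  of \<open>v\<close> with \<open>g\<close>. For modulated \<open>v\<close> these values are the
  Gabor coefficients up to a phase, and the Fourier transform makes them a product.\<close>

definition corr :: "('a \<Rightarrow> complex) \<Rightarrow> ('a \<Rightarrow> complex) \<Rightarrow> 'a \<Rightarrow> complex" where
  "corr v g x = (LINT t|\<mu>. v (x + t) * cnj (g t))"

lemma borel_measurable_corr:
  assumes [measurable]: "v \<in> borel_measurable borel" "g \<in> borel_measurable borel"
  shows "corr v g \<in> borel_measurable borel"
  unfolding corr_def by measurable

lemma integrable_corr:
  assumes v: "v \<in> L2_functions \<mu>" and g: "g \<in> L2_functions \<mu>"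
  shows "integrable \<mu> (\<lambda>t. v (x + t) * cnj (g t))"
proof -
  note [measurable] = L2_functions_borel[OF v] L2_functions_borel[OF g]
  show ?thesis
  proof (rule Bochner_Integration.integrable_bound)
    show "integrable \<mu> (\<lambda>t. (cmod (v (x + t)))\<^sup>2 + (cmod (g t))\<^sup>2)"
      using L2_functions_translate[OF v, of x] g by (simp add: L2_functions_def)
    have "a * b \<le> a\<^sup>2 + b\<^sup>2" for a b :: real
      using sum_squares_bound[of a b] zero_le_power2[of a] zero_le_power2[of b] by linarith
    then show "AE t in \<mu>. norm (v (x + t) * cnj (g t)) \<le> norm ((cmod (v (x + t)))\<^sup>2 + (cmod (g t))\<^sup>2)"
      by (simp add: norm_mult)
  qed measurable
qed

text \<open>A weighted form of the Cauchy-Schwarz inequality. The parameter \<open>e\<close> stays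
  free so that \<open>corr_tendsto\<close> can let it shrink with the distance of \<open>h n\<close>
  from \<open>g\<close>.\<close>

lemma cmod_corr_le:
  assumes v: "v \<in> L2_functions \<mu>" and g: "g \<in> L2_functions \<mu>" and e: "e > 0"
  shows "cmod (corr v g x) \<le> e * (L2_norm \<mu> v)\<^sup>2 + (L2_norm \<mu> g)\<^sup>2 / e"
proof -
  have v': "(\<lambda>t. v (x + t)) \<in> L2_functions \<mu>"
    by (rule L2_functions_translate[OF v])
  have eq: "(LINT t|\<mu>. (cmod (v (x + t)))\<^sup>2) = (L2_norm \<mu> v)\<^sup>2"
    using sqn_translate[OF L2_functions_borel[OF v], of x]
    by (simp add: sqn_eq_L2_norm v v' L2_norm_def)
  have "cmod (corr v g x) \<le> (LINT t|\<mu>. norm (v (x + t) * cnj (g t)))"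
    unfolding corr_def by (rule integral_norm_bound)
  also have "\<dots> \<le> (LINT t|\<mu>. e * (cmod (v (x + t)))\<^sup>2 + (cmod (g t))\<^sup>2 / e)"
  proof (rule integral_mono)
    show "integrable \<mu> (\<lambda>t. norm (v (x + t) * cnj (g t)))"
      using integrable_corr[OF v g] by (rule integrable_norm)
    show "integrable \<mu> (\<lambda>t. e * (cmod (v (x + t)))\<^sup>2 + (cmod (g t))\<^sup>2 / e)"
      using v' g by (simp add: L2_functions_def)
    fix t
    define a b where "a = cmod (v (x + t))" and "b = cmod (g t)"
    have "a * b \<le> (e * a) * (b / e) + (e * a - b)\<^sup>2 / e + a * b"
      using e by (simp add: a_def b_def)
    also have "\<dots> = e * a\<^sup>2 + b\<^sup>2 / e"
      using e by (simp add: field_simps power2_eq_square)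
    finally show "norm (v (x + t) * cnj (g t)) \<le> e * (cmod (v (x + t)))\<^sup>2 + (cmod (g t))\<^sup>2 / e"
      by (simp add: a_def b_def norm_mult)
  qed
  also have "\<dots> = e * (L2_norm \<mu> v)\<^sup>2 + (L2_norm \<mu> g)\<^sup>2 / e"
    using v' g by (simp add: eq L2_functions_def) (simp add: L2_norm_def)
  finally show ?thesis .
qed

lemma corr_diff:
  assumes v: "v \<in> L2_functions \<mu>" and g: "g \<in> L2_functions \<mu>" and h: "h \<in> L2_functions \<mu>"
  shows "corr v (\<lambda>t. g t - h t) = (\<lambda>x. corr v g x - corr v h x)"
  unfolding corr_def complex_cnj_diff right_diff_distrib
  by (intro ext Bochner_Integration.integral_diff integrable_corr v g h)

lemma corr_tendsto:
  assumes v: "v \<in> L2_functions \<mu>" and h: "\<And>n. h n \<in> L2_functions \<mu>" and g: "g \<in> L2_functions \<mu>"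
    and lim: "(\<lambda>n. sqn \<mu> (\<lambda>x. h n x - g x)) \<longlonglongrightarrow> 0"
  shows "(\<lambda>n. corr v (h n) x) \<longlonglongrightarrow> corr v g x"
proof -
  let ?b = "\<lambda>n. L2_norm \<mu> (\<lambda>x. h n x - g x)"
  have b: "?b \<longlonglongrightarrow> 0"
    using lim by (subst L2_norm_tendsto_0_iff) (auto intro: L2_functions_diff h g)
  have "(\<lambda>n. ?b n * (L2_norm \<mu> v)\<^sup>2 + ?b n + 1 / Suc n * (L2_norm \<mu> v)\<^sup>2) \<longlonglongrightarrow>
      0 * (L2_norm \<mu> v)\<^sup>2 + 0 + 0 * (L2_norm \<mu> v)\<^sup>2"
    by (intro tendsto_intros b LIMSEQ_Suc[OF lim_1_over_n])
  then have zero: "(\<lambda>n. ?b n * (L2_norm \<mu> v)\<^sup>2 + ?b n + 1 / Suc n * (L2_norm \<mu> v)\<^sup>2) \<longlonglongrightarrow> 0"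
    by simp
  have "norm (corr v (h n) x - corr v g x) \<le>
      ?b n * (L2_norm \<mu> v)\<^sup>2 + ?b n + 1 / Suc n * (L2_norm \<mu> v)\<^sup>2" for n
  proof -
    \<comment> \<open>The summand \<open>1 / Suc n\<close> keeps \<open>?e\<close> positive even
      when the distance is 0; since \<open>?e\<close> is at least the distance, the quotient below
      is at most the distance.\<close>
    let ?e = "?b n + 1 / Suc n"
    have e: "?e > 0"
      using L2_norm_nonneg[of \<mu> "\<lambda>x. h n x - g x"] by (intro add_nonneg_pos) auto
    have "corr v (h n) x - corr v g x = corr v (\<lambda>t. h n t - g t) x"
      by (simp add: corr_diff[OF v h g])
    also have "norm \<dots> \<le> ?e * (L2_norm \<mu> v)\<^sup>2 + (?b n)\<^sup>2 / ?e"
      by (intro cmod_corr_le v L2_functions_diff h g e)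
    also have "(?b n)\<^sup>2 / ?e \<le> ?b n"
      using e L2_norm_nonneg[of \<mu> "\<lambda>x. h n x - g x"]
      by (simp add: divide_le_eq power2_eq_square algebra_simps)
    finally show ?thesis
      by (simp add: algebra_simps)
  qed
  then have "(\<lambda>n. corr v (h n) x - corr v g x) \<longlonglongrightarrow> 0"
    by (intro Lim_null_comparison[OF always_eventually zero] allI)
  then show ?thesis
    by (simp add: LIM_zero_iff)
qed

lemma integrable_pair_corr:
  assumes v: "v \<in> L1_functions \<mu> \<inter> L2_functions \<mu>" and g: "g \<in> L1_functions \<mu> \<inter> L2_functions \<mu>"
  shows "integrable (\<mu> \<Otimes>\<^sub>M \<mu>) (\<lambda>(x, t). v (x + t) * cnj (g t))"
proof (rule integrableI_bounded)
  have [measurable]: "v \<in> borel_measurable borel" "g \<in> borel_measurable borel"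
    using v g by (auto intro: L2_functions_borel)
  show "(\<lambda>(x, t). v (x + t) * cnj (g t)) \<in> borel_measurable (\<mu> \<Otimes>\<^sub>M \<mu>)"
    by measurable
  have "(\<integral>\<^sup>+z. ennreal (norm (case z of (x, t) \<Rightarrow> v (x + t) * cnj (g t))) \<partial>(\<mu> \<Otimes>\<^sub>M \<mu>)) =
      (\<integral>\<^sup>+t. (\<integral>\<^sup>+x. ennreal (cmod (v (t + x))) * ennreal (cmod (g t)) \<partial>\<mu>) \<partial>\<mu>)"
    by (subst pair.nn_integral_snd[symmetric]) (auto simp: norm_mult ennreal_mult add.commute)
  also have "\<dots> = (\<integral>\<^sup>+t. (\<integral>\<^sup>+x. ennreal (cmod (v x)) \<partial>\<mu>) * ennreal (cmod (g t)) \<partial>\<mu>)"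
    by (simp add: nn_integral_multc nn_integral_translate[of "\<lambda>x. ennreal (cmod (v x))"])
  also have "\<dots> = (\<integral>\<^sup>+x. ennreal (cmod (v x)) \<partial>\<mu>) * (\<integral>\<^sup>+t. ennreal (cmod (g t)) \<partial>\<mu>)"
    by (simp add: nn_integral_cmult)
  also have "\<dots> < \<infinity>"
    using v g by (auto simp: L1_functions_def integrable_iff_bounded ennreal_mult_less_top)
  finally show "(\<integral>\<^sup>+z. ennreal (norm (case z of (x, t) \<Rightarrow> v (x + t) * cnj (g t))) \<partial>(\<mu> \<Otimes>\<^sub>M \<mu>)) < \<infinity>" .
qed

text \<open>By Fubini the correlation is integrable, by \<open>cmod_corr_le\<close> it is bounded,
  and a bounded integrable function is square integrable. Hence the isometry hypothesis applies to
  it directly.\<close>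

lemma corr_L1_L2:
  assumes v: "v \<in> L1_functions \<mu> \<inter> L2_functions \<mu>" and g: "g \<in> L1_functions \<mu> \<inter> L2_functions \<mu>"
  shows "corr v g \<in> L1_functions \<mu> \<inter> L2_functions \<mu>"
proof -
  have [measurable]: "v \<in> borel_measurable borel" "g \<in> borel_measurable borel"
    using v g by (auto intro: L2_functions_borel)
  note [measurable] = borel_measurable_corr[of v g]
  have int: "integrable \<mu> (corr v g)"
    using pair.integrable_fst'[OF integrable_pair_corr[OF v g]] by (simp add: corr_def[abs_def])
  define C where "C = (L2_norm \<mu> v)\<^sup>2 + (L2_norm \<mu> g)\<^sup>2"
  have C: "cmod (corr v g x) \<le> C" for x
    using cmod_corr_le[of v g 1 x] v g by (simp add: C_def)
  have "integrable \<mu> (\<lambda>x. (cmod (corr v g x))\<^sup>2)"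
  proof (rule Bochner_Integration.integrable_bound)
    show "integrable \<mu> (\<lambda>x. C * cmod (corr v g x))"
      using int by auto
    show "AE x in \<mu>. norm ((cmod (corr v g x))\<^sup>2) \<le> norm (C * cmod (corr v g x))"
      using C by (auto simp: power2_eq_square C_def intro!: mult_right_mono)
  qed measurable
  with int show ?thesis
    by (simp add: L1_functions_def L2_functions_def)
qed

lemma fourier_corr:
  assumes v: "v \<in> L1_functions \<mu> \<inter> L2_functions \<mu>" and g: "g \<in> L1_functions \<mu> \<inter> L2_functions \<mu>"
  shows "fourier \<mu> (corr v g) \<xi> = fourier \<mu> v \<xi> * cnj (fourier \<mu> g \<xi>)"
proof -
  have [measurable]: "v \<in> borel_measurable borel" "g \<in> borel_measurable borel"
    using v g by (auto intro: L2_functions_borel)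
  note [measurable] = borel_measurable_pairing
  let ?f = "\<lambda>x t. v (x + t) * cnj (g t) * cnj (pairing \<xi> x)"
  have int: "integrable (\<mu> \<Otimes>\<^sub>M \<mu>) (\<lambda>(x, t). ?f x t)"
    by (rule Bochner_Integration.integrable_bound[OF integrable_pair_corr[OF v g]])
      (auto simp: norm_mult)
  have "fourier \<mu> (corr v g) \<xi> = (LINT x|\<mu>. (LINT t|\<mu>. ?f x t))"
    unfolding fourier_def corr_def by simp
  also have "\<dots> = (LINT t|\<mu>. (LINT x|\<mu>. ?f x t))"
    by (rule pair.Fubini_integral[OF int, symmetric])
  also have "\<dots> = (LINT t|\<mu>. cnj (g t) * pairing \<xi> t * (LINT x|\<mu>. v (t + x) * cnj (pairing \<xi> (t + x))))"
  proof (rule Bochner_Integration.integral_cong[OF refl])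
    fix t
    \<comment> \<open>The character at \<open>x\<close> is written through its value at
      \<open>t + x\<close>, so that the inner integral becomes a translate of the one defining
      \<open>fourier \<mu> v \<xi>\<close>.\<close>
    have "?f x t = cnj (g t) * pairing \<xi> t * (v (t + x) * cnj (pairing \<xi> (t + x)))" for x
      by (simp add: pairing_add add.commute)
    then show "(LINT x|\<mu>. ?f x t) =
        cnj (g t) * pairing \<xi> t * (LINT x|\<mu>. v (t + x) * cnj (pairing \<xi> (t + x)))"
      by (simp only: integral_mult_right_zero)
  qed
  also have "\<dots> = (LINT t|\<mu>. cnj (g t * cnj (pairing \<xi> t)) * fourier \<mu> v \<xi>)"
    unfolding fourier_def
    by (subst integral_translate[of "\<lambda>x. v x * cnj (pairing \<xi> x)"]) simp_all
  also have "\<dots> = fourier \<mu> v \<xi> * cnj (fourier \<mu> g \<xi>)"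
    unfolding fourier_def
    by (simp only: integral_mult_left_zero Bochner_Integration.integral_cnj mult.commute)
  finally show ?thesis .
qed

text \<open>For \<open>g\<close> merely square integrable, \<open>corr v g\<close> need not be
  integrable and its transform is not directly available. The identity is proved for integrable
  approximants of \<open>g\<close> and passed to the limit on both sides; integrability of
  \<open>v\<close> keeps its transform bounded, so multiplication by it is continuous.\<close>

lemma sqn_corr:
  assumes unitary: "fourier_unitary \<mu> \<nu>" and v: "v \<in> L1_functions \<mu> \<inter> L2_functions \<mu>"
    and g: "g \<in> L2_functions \<mu>" and G: "is_fourier_L2 \<mu> \<nu> g G"
  shows "sqn \<mu> (corr v g) = sqn \<nu> (\<lambda>\<xi>. fourier \<mu> v \<xi> * cnj (G \<xi>))"
proof -
  obtain f where f: "\<And>n. f n \<in> L1_functions \<mu> \<inter> L2_functions \<mu>"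
    and F: "\<And>n. fourier \<mu> (f n) \<in> L2_functions \<nu>"
    and f_lim: "(\<lambda>n. sqn \<mu> (\<lambda>x. f n x - g x)) \<longlonglongrightarrow> 0"
    and F_lim: "(\<lambda>n. sqn \<nu> (\<lambda>\<xi>. fourier \<mu> (f n) \<xi> - G \<xi>)) \<longlonglongrightarrow> 0"
    and G2: "G \<in> L2_functions \<nu>"
    using G unfolding is_fourier_L2_iff_sqn[OF g] by blast
  have vV: "fourier \<mu> v \<in> L2_functions \<nu>"
    by (rule fourier_unitary_L2[OF unitary v])
  note [measurable] = L2_functions_measurable[OF F] L2_functions_measurable[OF G2]
    L2_functions_measurable[OF vV]
  have [measurable]: "v \<in> borel_measurable borel" "g \<in> borel_measurable borel"
     "\<And>n. f n \<in> borel_measurable borel"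
    using v g f by (auto intro: L2_functions_borel)
  have [measurable]: "corr v g \<in> borel_measurable \<mu>" "\<And>n. corr v (f n) \<in> borel_measurable \<mu>"
    using borel_measurable_corr[of v] by (auto simp: measurable_cong_sets[OF sets_\<mu>])
  define C where "C = ((LINT x|\<mu>. cmod (v x)))\<^sup>2"
  have mult_le: "sqn \<nu> (\<lambda>\<xi>. fourier \<mu> v \<xi> * cnj (h \<xi>)) \<le> ennreal C * sqn \<nu> h"
    if [measurable]: "h \<in> borel_measurable \<nu>" for h
    unfolding sqn_def
  proof (subst nn_integral_cmult[symmetric])
    show "(\<integral>\<^sup>+\<xi>. ennreal ((cmod (fourier \<mu> v \<xi> * cnj (h \<xi>)))\<^sup>2) \<partial>\<nu>) \<le>
        (\<integral>\<^sup>+\<xi>. ennreal C * ennreal ((cmod (h \<xi>))\<^sup>2) \<partial>\<nu>)"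
    proof (rule nn_integral_mono)
      fix \<xi>
      have "(cmod (fourier \<mu> v \<xi>))\<^sup>2 \<le> C"
        unfolding C_def by (intro power_mono cmod_fourier_le) auto
      then show "ennreal ((cmod (fourier \<mu> v \<xi> * cnj (h \<xi>)))\<^sup>2) \<le> ennreal C * ennreal ((cmod (h \<xi>))\<^sup>2)"
        by (simp add: norm_mult power_mult_distrib C_def mult_right_mono flip: ennreal_mult)
    qed
  qed measurable
  have F_lim': "(\<lambda>n. sqn \<nu> (\<lambda>\<xi>. fourier \<mu> v \<xi> * cnj (fourier \<mu> (f n) \<xi>) - fourier \<mu> v \<xi> * cnj (G \<xi>))) \<longlonglongrightarrow> 0"
  proof (rule tendsto_sandwich[OF _ _ tendsto_const])
    have "(\<lambda>n. ennreal C * sqn \<nu> (\<lambda>\<xi>. fourier \<mu> (f n) \<xi> - G \<xi>)) \<longlonglongrightarrow> ennreal C * 0"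
      by (intro ennreal_tendsto_cmult F_lim) auto
    then show "(\<lambda>n. ennreal C * sqn \<nu> (\<lambda>\<xi>. fourier \<mu> (f n) \<xi> - G \<xi>)) \<longlonglongrightarrow> 0" by simp
    have "sqn \<nu> (\<lambda>\<xi>. fourier \<mu> v \<xi> * cnj (fourier \<mu> (f n) \<xi>) - fourier \<mu> v \<xi> * cnj (G \<xi>)) \<le>
       ennreal C * sqn \<nu> (\<lambda>\<xi>. fourier \<mu> (f n) \<xi> - G \<xi>)" for n
      using mult_le[of "\<lambda>\<xi>. fourier \<mu> (f n) \<xi> - G \<xi>"] by (simp add: right_diff_distrib)
    then show "\<forall>\<^sub>F n in sequentially. sqn \<nu> (\<lambda>\<xi>. fourier \<mu> v \<xi> * cnj (fourier \<mu> (f n) \<xi>) - fourier \<mu> v \<xi> * cnj (G \<xi>)) \<le>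
       ennreal C * sqn \<nu> (\<lambda>\<xi>. fourier \<mu> (f n) \<xi> - G \<xi>)" by simp
  qed auto
  have corr_L1: "sqn \<mu> (corr v h) = sqn \<nu> (\<lambda>\<xi>. fourier \<mu> v \<xi> * cnj (fourier \<mu> h \<xi>))"
    if "h \<in> L1_functions \<mu> \<inter> L2_functions \<mu>" for h
    using fourier_unitary_sqn[OF unitary corr_L1_L2[OF v that]] by (simp add: fourier_corr[OF v that, abs_def])
  \<comment> \<open>\<open>corr_tendsto\<close> identifies the pointwise limit; the identity for
    integrable functions, applied to differences, upgrades this to convergence in norm.\<close>
  have corr_lim: "(\<lambda>n. sqn \<mu> (\<lambda>x. corr v (f n) x - corr v g x)) \<longlonglongrightarrow> 0"
  proof (rule sqn_tendsto_0_transfer[OF _ _ _ _ F_lim, where c = C])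
    show "AE x in \<mu>. (\<lambda>m. corr v (f m) x) \<longlonglongrightarrow> corr v g x"
      using v f g f_lim by (intro AE_I2 corr_tendsto) auto
    fix m n
    have "sqn \<mu> (\<lambda>x. corr v (f m) x - corr v (f n) x) = sqn \<mu> (corr v (\<lambda>t. f m t - f n t))"
      using v f by (simp add: corr_diff)
    also have "\<dots> = sqn \<nu> (\<lambda>\<xi>. fourier \<mu> v \<xi> * cnj (fourier \<mu> (f m) \<xi> - fourier \<mu> (f n) \<xi>))"
      using f by (simp add: corr_L1[OF L1_L2_functions_diff] fourier_diff sets_\<mu>)
    also have "\<dots> \<le> ennreal C * sqn \<nu> (\<lambda>\<xi>. fourier \<mu> (f m) \<xi> - fourier \<mu> (f n) \<xi>)"
      by (rule mult_le) measurable
    finally show "sqn \<mu> (\<lambda>x. corr v (f m) x - corr v (f n) x) \<le>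
        ennreal C * sqn \<nu> (\<lambda>\<xi>. fourier \<mu> (f m) \<xi> - fourier \<mu> (f n) \<xi>)" .
  qed measurable
  show ?thesis
  proof (rule antisym)
    have "sqn \<mu> (corr v g) \<le> ennreal 1 * sqn \<nu> (\<lambda>\<xi>. fourier \<mu> v \<xi> * cnj (G \<xi>))"
      by (rule sqn_limit_le[OF _ _ _ _ corr_lim F_lim']) (auto simp: corr_L1[OF f])
    then show "sqn \<mu> (corr v g) \<le> sqn \<nu> (\<lambda>\<xi>. fourier \<mu> v \<xi> * cnj (G \<xi>))" by simp
    have "sqn \<nu> (\<lambda>\<xi>. fourier \<mu> v \<xi> * cnj (G \<xi>)) \<le> ennreal 1 * sqn \<mu> (corr v g)"
      by (rule sqn_limit_le[OF _ _ _ _ F_lim' corr_lim]) (auto simp: corr_L1[OF f])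
    then show "sqn \<nu> (\<lambda>\<xi>. fourier \<mu> v \<xi> * cnj (G \<xi>)) \<le> sqn \<mu> (corr v g)" by simp
  qed
qed

end

section \<open>Groups with a proper invariant metric\<close>

text \<open>Stands in for the second countable group structure that the type of the dual does not
  carry: from the metric come a countable dense set, measurable subtraction and sigma-finiteness of
  Haar measure.\<close>

locale proper_metric_group = Metric_space UNIV d
  for d :: "'b::{topological_space, ab_group_add} \<Rightarrow> 'b \<Rightarrow> real" +
  assumes d_translate: "d (p + s) (p' + s) = d p p'"
    and mtopology_eq: "mtopology = euclidean"
    and compact_mcball: "compact (mcball p r)"
begin

lemma open_mball: "open (mball x r)"
  using openin_mball[of x r] by (simp add: mtopology_eq)

lemma open_iff_mball: "open U \<longleftrightarrow> (\<forall>x\<in>U. \<exists>r>0. mball x r \<subseteq> U)"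
  using openin_mtopology[of U] by (auto simp: mtopology_eq)

text \<open>Compactness of the closed balls about 0 gives a finite net for each integer radius and
  each mesh \<open>1 / Suc k\<close>; the union of these nets is dense.\<close>

lemma countable_dense:
  obtains D where "countable D" "\<And>x r. r > 0 \<Longrightarrow> \<exists>e\<in>D. d e x < r"
proof -
  have "\<exists>F. finite F \<and> mcball 0 (real n) \<subseteq> (\<Union>x\<in>F. mball x (1 / Suc k))" for n k :: nat
  proof -
    have "mcball 0 (real n) \<subseteq> (\<Union>x\<in>UNIV. mball x (1 / Suc k))"
    proof
      fix x
      have "x \<in> mball x (1 / Suc k)"
        by (subst centre_in_mball_iff) simp
      then show "x \<in> (\<Union>x\<in>UNIV. mball x (1 / Suc k))"
        by blast
    qed
    from compactE_image[OF compact_mcball _ this] open_mball show ?thesis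
      by metis
  qed
  then obtain F where F: "\<And>n k. finite (F n k)"
      "\<And>n k. mcball 0 (real n) \<subseteq> (\<Union>x\<in>F n k. mball x (1 / Suc k))"
    by metis
  show ?thesis
  proof (rule that[of "\<Union>n k. F n k"])
    show "countable (\<Union>n k. F n k)"
      using F(1) by (intro countable_UN countable_finite countableI_type)
    fix x and r :: real assume "r > 0"
    then obtain k where k: "1 / Suc k < r"
      using nat_approx_posE by blast
    obtain n where n: "d 0 x \<le> real n"
      using real_arch_simple by blast
    then have "x \<in> mcball 0 (real n)" by simp
    then obtain e where "e \<in> F n k" "x \<in> mball e (1 / Suc k)"
      using F(2) by blast
    then show "\<exists>e\<in>(\<Union>n k. F n k). d e x < r"
      using k by (intro bexI[of _ e]) auto
  qed
qed

lemma d_diff_le: "d (x - y) (x' - y') \<le> d x x' + d y y'"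
proof -
  have "d (x - y) (x' - y') \<le> d (x - y) (x' - y) + d (x' - y) (x' - y')"
    by (rule triangle) auto
  \<comment> \<open>Both remaining distances follow from invariance; the second uses translation by
    \<open>y + y' - x'\<close>, which sends the two points to \<open>y'\<close> and
    \<open>y\<close>.\<close>
  also have "d (x - y) (x' - y) = d x x'"
    using d_translate[of x "- y" x'] by simp
  also have "d (x' - y) (x' - y') = d y' y"
    using d_translate[of "x' - y" "y + y' - x'" "x' - y'"] by (simp add: algebra_simps)
  finally show ?thesis by (simp add: commute)
qed

text \<open>Measurability is needed for the product sigma-algebra, so continuity alone does not
  suffice. The preimage of an open set is exhibited as a countable union of products of balls
  centred at points of the dense set.\<close>

lemma borel_measurable_diff_pair: "(\<lambda>(x :: 'b, y). x - y) \<in> borel_measurable (borel \<Otimes>\<^sub>M borel)"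
proof (rule borel_measurableI)
  fix U :: "'b set" assume U: "open U"
  obtain D where D: "countable D" "\<And>x r. r > 0 \<Longrightarrow> \<exists>e\<in>D. d e x < r"
    using countable_dense by blast
  define I where "I = {(e, f, k :: nat). e \<in> D \<and> f \<in> D \<and>
      (\<forall>x\<in>mball e (1 / Suc k). \<forall>y\<in>mball f (1 / Suc k). x - y \<in> U)}"
  have "I \<subseteq> D \<times> D \<times> UNIV" by (auto simp: I_def)
  then have "countable I"
    by (rule countable_subset) (use D in auto)
  then have "(\<Union>(e, f, k)\<in>I. mball e (1 / Suc k) \<times> mball f (1 / Suc k)) \<in> sets (borel \<Otimes>\<^sub>M borel)"
    by (intro sets.countable_UN') (auto intro!: pair_measureI borel_open open_mball)
  moreover have "(\<lambda>(x, y). x - y) -` U = (\<Union>(e, f, k)\<in>I. mball e (1 / Suc k) \<times> mball f (1 / Suc k))"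
  proof (intro set_eqI iffI)
    fix z assume "z \<in> (\<lambda>(x, y). x - y) -` U"
    then obtain x y where z: "z = (x, y)" "x - y \<in> U" by (cases z) auto
    then obtain r where r: "r > 0" "mball (x - y) r \<subseteq> U"
      using U open_iff_mball by blast
    \<comment> \<open>Passing through a centre costs two radii in each coordinate, hence four in all
      for the difference.\<close>
    obtain k where k: "1 / Suc k < r / 4"
      using nat_approx_posE[of "r / 4"] r by auto
    obtain e f where ef: "e \<in> D" "f \<in> D" "d e x < 1 / Suc k" "d f y < 1 / Suc k"
      using D(2)[of "1 / Suc k" x] D(2)[of "1 / Suc k" y] by auto
    have "x' - y' \<in> U" if "d e x' < 1 / Suc k" "d f y' < 1 / Suc k" for x' y'
    proof -
      have "d x x' \<le> d e x + d e x'" "d y y' \<le> d f y + d f y'"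
        using triangle[of x e x'] triangle[of y f y'] by (auto simp: commute)
      then have "d (x - y) (x' - y') < r"
        using d_diff_le[of x y x' y'] ef that k by linarith
      then show ?thesis using r by auto
    qed
    then have "(e, f, k) \<in> I"
      using ef by (auto simp: I_def)
    then show "z \<in> (\<Union>(e, f, k)\<in>I. mball e (1 / Suc k) \<times> mball f (1 / Suc k))"
      using z ef by (intro UN_I[of "(e, f, k)"]) auto
  qed (auto simp: I_def)
  ultimately show "(\<lambda>(x, y). x - y) -` U \<inter> space (borel \<Otimes>\<^sub>M borel) \<in> sets (borel \<Otimes>\<^sub>M borel)"
    by (simp add: space_pair_measure)
qed

lemma borel_measurable_translate: "(\<lambda>x. p + x) \<in> borel_measurable borel" for p :: 'b
proof -
  have "(\<lambda>x. (x, - p)) \<in> borel \<rightarrow>\<^sub>M borel \<Otimes>\<^sub>M borel"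
    by measurable
  from measurable_compose[OF this borel_measurable_diff_pair] show ?thesis
    by (simp add: add.commute)
qed

lemma sigma_finite_haar:
  fixes M :: "'b measure"
  assumes M: "haar_measure euclidean add M"
  shows "sigma_finite_measure M"
proof (rule sigma_finite_measure.intro, intro exI conjI ballI)
  let ?A = "range (\<lambda>n. mcball 0 (real n))"
  have "closed (mcball x r)" for x r
    using closedin_mcball[of x r] by (simp add: mtopology_eq)
  then show "?A \<subseteq> sets M"
    unfolding haar_sets[OF M] by (intro image_subsetI borel_closed)
  show "\<Union>?A = space M"
    unfolding haar_sets[OF M] using real_arch_simple by auto
  fix a assume "a \<in> ?A"
  then have "compact a"
    using compact_mcball by (elim imageE) simp
  then have "emeasure M a < \<infinity>"
    using M unfolding haar_measure_def by simp
  then show "emeasure M a \<noteq> \<infinity>" by simp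
qed simp

end

section \<open>Gabor frames\<close>

context haar_group
begin

lemma L1_L2_functions_modulate:
  assumes u: "u \<in> L1_functions \<mu> \<inter> L2_functions \<mu>"
  shows "(\<lambda>t. u t * cnj (pairing p t)) \<in> L1_functions \<mu> \<inter> L2_functions \<mu>"
proof -
  have "integrable \<mu> (\<lambda>t. u t * cnj (pairing p t))"
    using u by (intro integrable_fourier sets_\<mu>) auto
  then show ?thesis
    using u by (auto simp: L1_functions_def L2_functions_def norm_mult)
qed

lemma fourier_modulate: "fourier \<mu> (\<lambda>t. u t * cnj (pairing p t)) \<xi> = fourier \<mu> u (p + \<xi>)"
  unfolding fourier_def by (simp add: plus_dual.rep_eq mult.assoc)

text \<open>Substituting \<open>q + t\<close> for \<open>t\<close> and moving the character onto
  \<open>u\<close> leaves the phase \<open>pairing p y\<close>, of modulus 1. Translating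
  \<open>u\<close> by \<open>y\<close> thus replaces the sampling point \<open>q\<close> by
  \<open>y + q\<close>.\<close>

lemma cmod_inner_tf_shift_translate:
  assumes [measurable]: "u \<in> borel_measurable borel" "g \<in> borel_measurable borel"
  shows "cmod (L2_inner \<mu> (\<lambda>t. u (y + t)) (tf_shift p q g)) =
    cmod (corr (\<lambda>t. u t * cnj (pairing p t)) g (y + q))"
proof -
  note [measurable] = borel_measurable_pairing
  have "L2_inner \<mu> (\<lambda>t. u (y + t)) (tf_shift p q g) =
      (LINT t|\<mu>. u (y + t) * cnj (pairing p t * g (t - q)))"
    by (simp add: L2_inner_def tf_shift_def)
  also have "\<dots> = (LINT t|\<mu>. u (y + (q + t)) * cnj (pairing p (q + t) * g (q + t - q)))"
    by (rule integral_translate[symmetric]) measurable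
  also have "\<dots> = (LINT t|\<mu>. pairing p y * (u (y + q + t) * cnj (pairing p (y + q + t)) * cnj (g t)))"
  proof (rule Bochner_Integration.integral_cong[OF refl])
    fix t
    have "cnj (pairing p (q + t)) = pairing p y * cnj (pairing p (y + (q + t)))"
      by (simp add: pairing_add[of p y] flip: mult.assoc)
    then show "u (y + (q + t)) * cnj (pairing p (q + t) * g (q + t - q)) =
        pairing p y * (u (y + q + t) * cnj (pairing p (y + q + t)) * cnj (g t))"
      by (simp add: add.assoc)
  qed
  also have "\<dots> = pairing p y * corr (\<lambda>t. u t * cnj (pairing p t)) g (y + q)"
    by (simp add: corr_def)
  finally show ?thesis
    by (simp add: norm_mult)
qed

lemma gabor_frame_averaged:
  assumes \<Lambda>: "additive_subgroup \<Lambda>" "closed \<Lambda>" "compact_space (quotient_topology \<Lambda>)"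
    and m: "haar_measure (top_of_set \<Lambda>) (+) m"
    and \<kappa>: "emeasure \<kappa> (space \<kappa>) = 1" and weil: "weil_formula \<mu> m \<kappa>"
    and \<sigma>: "sigma_finite_measure \<sigma>"
    and pairing_meas: "(\<lambda>(x, p). pairing p x) \<in> borel_measurable (\<mu> \<Otimes>\<^sub>M \<sigma>)"
    and g: "g \<in> L2_functions \<mu>" and u: "u \<in> L2_functions \<mu>"
    and frame: "gabor_frame \<mu> m \<sigma> g A B"
  defines "E \<equiv> \<integral>\<^sup>+p. sqn \<mu> (corr (\<lambda>t. u t * cnj (pairing p t)) g) \<partial>\<sigma>"
  shows "ennreal (A * (L2_norm \<mu> u)\<^sup>2) \<le> E" "E \<le> ennreal (B * (L2_norm \<mu> u)\<^sup>2)"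
proof -
  note m_sets = haar_sets_closed[OF \<Lambda>(2) m]
  interpret m: sigma_finite_measure m
    by (rule haar_sigma_finite[OF lc \<Lambda>(2) m])
  interpret \<sigma>: sigma_finite_measure \<sigma> by fact
  interpret \<sigma>\<mu>: pair_sigma_finite \<sigma> \<mu> ..
  have "(\<lambda>q. q) \<in> borel_measurable m"
    by (auto simp: measurable_def m_sets sets_restrict_space)
  note [measurable] = measurable_compose[OF measurable_snd this]
  note [measurable] = L2_functions_borel[OF g] L2_functions_borel[OF u]
  \<comment> \<open>Joint measurability is pulled back along arbitrary measurable maps, since the
    character is evaluated below at sums of variables.\<close>
  have pairing_meas': "(\<lambda>z. pairing (f z) (h z)) \<in> borel_measurable N"
    if "f \<in> N \<rightarrow>\<^sub>M \<sigma>" "h \<in> borel_measurable N" for N and f :: "'z \<Rightarrow> 'a dual" and h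
  proof -
    have "h \<in> N \<rightarrow>\<^sub>M \<mu>"
      using that(2) by (simp add: measurable_cong_sets[OF refl sets_\<mu>])
    then have "(\<lambda>z. (h z, f z)) \<in> N \<rightarrow>\<^sub>M \<mu> \<Otimes>\<^sub>M \<sigma>"
      using that(1) by measurable
    from measurable_compose[OF this pairing_meas] show ?thesis by simp
  qed
  define w where "w p = corr (\<lambda>t. u t * cnj (pairing p t)) g" for p
  have w_meas: "(\<lambda>(p, y). w p y) \<in> borel_measurable (\<sigma> \<Otimes>\<^sub>M borel)"
    unfolding w_def corr_def split_beta
  proof (rule borel_measurable_lebesgue_integral)
    have [measurable]: "(\<lambda>z. pairing (fst (fst z)) (snd (fst z) + snd z)) \<in>
        borel_measurable ((\<sigma> \<Otimes>\<^sub>M borel) \<Otimes>\<^sub>M \<mu>)"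
      by (rule pairing_meas') measurable
    show "(\<lambda>(x, t). u (snd x + t) * cnj (pairing (fst x) (snd x + t)) * cnj (g t))
      \<in> borel_measurable ((\<sigma> \<Otimes>\<^sub>M borel) \<Otimes>\<^sub>M \<mu>)"
      unfolding split_beta by measurable
  qed
  define k where "k p y = ennreal ((cmod (w p y))\<^sup>2)" for p y
  have k_meas: "(\<lambda>z. k (f z) (h z)) \<in> borel_measurable N"
    if "f \<in> N \<rightarrow>\<^sub>M \<sigma>" "h \<in> borel_measurable N" for N and f :: "'z \<Rightarrow> 'a dual" and h
  proof -
    have "(\<lambda>z. (f z, h z)) \<in> N \<rightarrow>\<^sub>M \<sigma> \<Otimes>\<^sub>M borel"
      using that by measurable
    from measurable_compose[OF this w_meas] have [measurable]: "(\<lambda>z. w (f z) (h z)) \<in> borel_measurable N"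
      by simp
    show ?thesis unfolding k_def by measurable
  qed
  obtain \<theta> :: "'a \<Rightarrow> ennreal" where \<theta>[measurable]: "\<theta> \<in> borel_measurable borel"
    and one: "\<And>y. (\<integral>\<^sup>+q. \<theta> (y + q) \<partial>m) = 1"
    using bruhat_function[OF lc \<Lambda> m] by blast
  \<comment> \<open>Inversion invariance removes the sign. In Weil's formula all inner integrals of
    \<open>\<theta>\<close> equal 1, and \<open>\<kappa>\<close> has mass 1.\<close>
  have "(\<integral>\<^sup>+y. \<theta> (- y) \<partial>\<mu>) = (\<integral>\<^sup>+y. \<theta> y \<partial>\<mu>)"
    by (rule haar_nn_integral_minus[OF lc haar \<theta>])
  also have "\<dots> = 1"
    using weil \<theta> \<kappa> by (simp add: weil_formula_def one)
  finally have mass: "(\<integral>\<^sup>+y. \<theta> (- y) \<partial>\<mu>) = 1" .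
  \<comment> \<open>\<open>I y\<close> is the frame energy of \<open>u\<close> translated by
    \<open>y\<close>, so it satisfies the same bounds for every \<open>y\<close>.\<close>
  define I where "I y = (\<integral>\<^sup>+p. (\<integral>\<^sup>+q. k p (y + q) \<partial>m) \<partial>\<sigma>)" for y
  have I: "ennreal (A * (L2_norm \<mu> u)\<^sup>2) \<le> I y" "I y \<le> ennreal (B * (L2_norm \<mu> u)\<^sup>2)" for y
  proof -
    have u': "(\<lambda>t. u (y + t)) \<in> L2_functions \<mu>"
      by (rule L2_functions_translate[OF u])
    have "(L2_norm \<mu> (\<lambda>t. u (y + t)))\<^sup>2 = (L2_norm \<mu> u)\<^sup>2"
      using sqn_translate[of u y] by (simp add: sqn_eq_L2_norm u u' ennreal_inj)
    moreover have "I y = (\<integral>\<^sup>+p. (\<integral>\<^sup>+q. ennreal ((cmod (L2_inner \<mu> (\<lambda>t. u (y + t)) (tf_shift p q g)))\<^sup>2) \<partial>m) \<partial>\<sigma>)"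
      by (simp add: I_def k_def w_def cmod_inner_tf_shift_translate)
    ultimately show "ennreal (A * (L2_norm \<mu> u)\<^sup>2) \<le> I y" "I y \<le> ennreal (B * (L2_norm \<mu> u)\<^sup>2)"
      using frame u' unfolding gabor_frame_def Let_def by metis+
  qed
  have [measurable]: "k p \<in> borel_measurable borel" if "p \<in> space \<sigma>" for p
    using that by (intro k_meas) auto
  have inner_meas: "(\<lambda>(p, y). \<integral>\<^sup>+q. k p (y + q) \<partial>m) \<in> borel_measurable (\<sigma> \<Otimes>\<^sub>M \<mu>)"
    unfolding split_beta
    by (intro m.borel_measurable_nn_integral) (unfold split_beta, intro k_meas, measurable)
  have "E = (\<integral>\<^sup>+p. (\<integral>\<^sup>+y. \<theta> (- y) * (\<integral>\<^sup>+q. k p (y + q) \<partial>m) \<partial>\<mu>) \<partial>\<sigma>)"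
    unfolding E_def
  proof (rule nn_integral_cong)
    fix p assume "p \<in> space \<sigma>"
    then have "(\<integral>\<^sup>+y. \<theta> (- y) * (\<integral>\<^sup>+q. k p (y + q) \<partial>m) \<partial>\<mu>) = (\<integral>\<^sup>+y. k p y \<partial>\<mu>)"
      by (intro bruhat_average[OF lc haar \<Lambda>(2) m] one) measurable
    then show "sqn \<mu> (corr (\<lambda>t. u t * cnj (pairing p t)) g) =
        (\<integral>\<^sup>+y. \<theta> (- y) * (\<integral>\<^sup>+q. k p (y + q) \<partial>m) \<partial>\<mu>)"
      by (simp add: sqn_def k_def w_def)
  qed
  also have "\<dots> = (\<integral>\<^sup>+y. (\<integral>\<^sup>+p. \<theta> (- y) * (\<integral>\<^sup>+q. k p (y + q) \<partial>m) \<partial>\<sigma>) \<partial>\<mu>)"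
  proof (rule \<sigma>\<mu>.Fubini'[symmetric])
    note [measurable] = inner_meas[unfolded split_beta]
    show "(\<lambda>(p, y). \<theta> (- y) * (\<integral>\<^sup>+q. k p (y + q) \<partial>m)) \<in> borel_measurable (\<sigma> \<Otimes>\<^sub>M \<mu>)"
      unfolding split_beta by measurable
  qed
  also have "\<dots> = (\<integral>\<^sup>+y. \<theta> (- y) * I y \<partial>\<mu>)"
    unfolding I_def
  proof (intro nn_integral_cong nn_integral_cmult)
    fix y assume "y \<in> space \<mu>"
    then have "(\<lambda>p. (p, y)) \<in> \<sigma> \<rightarrow>\<^sub>M \<sigma> \<Otimes>\<^sub>M \<mu>" by measurable
    from measurable_compose[OF this inner_meas]
    show "(\<lambda>p. \<integral>\<^sup>+q. k p (y + q) \<partial>m) \<in> borel_measurable \<sigma>" by simp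
  qed
  finally have E: "E = (\<integral>\<^sup>+y. \<theta> (- y) * I y \<partial>\<mu>)" .
  \<comment> \<open>Averaging a constant against a weight of mass 1 returns it, so \<open>A\<close>
    and \<open>B\<close> are unchanged.\<close>
  have const: "(\<integral>\<^sup>+y. \<theta> (- y) * c \<partial>\<mu>) = c" for c
    by (subst nn_integral_multc) (auto simp: mass)
  have "(\<integral>\<^sup>+y. \<theta> (- y) * ennreal (A * (L2_norm \<mu> u)\<^sup>2) \<partial>\<mu>) \<le> E"
    unfolding E by (intro nn_integral_mono mult_left_mono I) auto
  then show "ennreal (A * (L2_norm \<mu> u)\<^sup>2) \<le> E" by (simp add: const)
  have "E \<le> (\<integral>\<^sup>+y. \<theta> (- y) * ennreal (B * (L2_norm \<mu> u)\<^sup>2) \<partial>\<mu>)"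
    unfolding E by (intro nn_integral_mono mult_left_mono I) auto
  then show "E \<le> ennreal (B * (L2_norm \<mu> u)\<^sup>2)" by (simp add: const)
qed

end

theorem theorem30:
  fixes \<mu> :: "'a::{topological_ab_group_add, t2_space, second_countable_topology} measure"
    and \<nu> :: "'a dual measure"
    and \<Lambda> :: "'a set"
    and \<mu>\<^sub>\<Lambda> :: "'a measure"
    and \<kappa> :: "'a set measure"
    and d :: "'a dual \<Rightarrow> 'a dual \<Rightarrow> real"
    and P :: "'a dual set"
    and \<sigma> :: "'a dual measure"
    and g :: "'a \<Rightarrow> complex"
    and A B :: real
  assumes "locally_compact_space (euclidean :: 'a topology)"
    and "haar_measure euclidean (+) \<mu>"
    and "haar_measure euclidean (+) \<nu>"
    and "fourier_unitary \<mu> \<nu>"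
    and "additive_subgroup \<Lambda>"
    and "closed \<Lambda>"
    and "compact_space (quotient_topology \<Lambda>)"
    and "haar_measure (top_of_set \<Lambda>) (+) \<mu>\<^sub>\<Lambda>"
    and "haar_measure (quotient_topology \<Lambda>) (+) \<kappa>"
    and "emeasure \<kappa> (space \<kappa>) = 1"
    and "weil_formula \<mu> \<mu>\<^sub>\<Lambda> \<kappa>"
    and "Metric_space UNIV d"
    and "\<And>p p' s. d (p + s) (p' + s) = d p p'"
    and "Metric_space.mtopology UNIV d = euclidean"
    and "\<And>p r. compact (Metric_space.mcball UNIV d p r)"
    and "weakly_doubling d \<nu>"
    and "space \<sigma> = P"
    and "sets (restrict_space borel P) \<subseteq> sets \<sigma>"
    and "sigma_finite_measure \<sigma>"
    and "(\<lambda>(x, p). pairing p x) \<in> borel_measurable (\<mu> \<Otimes>\<^sub>M \<sigma>)"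
    and "(\<lambda>p. d p 0) \<in> borel_measurable \<sigma>"
    and "g \<in> L2_functions \<mu>"
    and "0 < A" and "A \<le> B"
    and "gabor_frame \<mu> \<mu>\<^sub>\<Lambda> \<sigma> g A B"
  shows "AE \<xi> in \<nu>.
           ennreal A \<le> (\<integral>\<^sup>+p. ennreal ((cmod (fourier_L2 \<mu> \<nu> g (\<xi> - p)))\<^sup>2) \<partial>\<sigma>) \<and>
           (\<integral>\<^sup>+p. ennreal ((cmod (fourier_L2 \<mu> \<nu> g (\<xi> - p)))\<^sup>2) \<partial>\<sigma>) \<le> ennreal B"
proof -
  note unitary = assms(4) and g = assms(22) and A = assms(23)
  interpret haar_group \<mu>
    using assms(1,2) by unfold_locales
  interpret Metric_space UNIV d by fact
  interpret proper_metric_group d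
    using assms(13-15) by unfold_locales
  interpret \<nu>: sigma_finite_measure \<nu>
    by (rule sigma_finite_haar[OF assms(3)])
  interpret \<sigma>: sigma_finite_measure \<sigma> by fact
  interpret \<nu>\<sigma>: pair_sigma_finite \<nu> \<sigma> ..
  note [measurable_cong] = haar_sets(1)[OF assms(3)]
  define G where "G = fourier_L2 \<mu> \<nu> g"
  have G: "is_fourier_L2 \<mu> \<nu> g G"
    unfolding G_def by (rule is_fourier_fourier_L2[OF sets_\<mu> unitary g])
  have G_meas[measurable]: "G \<in> borel_measurable borel"
    using G L2_functions_measurable[of G \<nu>]
    by (auto simp: is_fourier_L2_def measurable_cong_sets[OF haar_sets(1)[OF assms(3)] refl])
  \<comment> \<open>The sigma-algebra of \<open>\<sigma>\<close> may exceed the Borel trace on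
    \<open>P\<close>; the inclusion of sigma-algebras says that the embedding of \<open>P\<close> in
    the dual is Borel measurable.\<close>
  have \<sigma>_meas: "(\<lambda>p. p) \<in> borel_measurable \<sigma>"
    using assms(17,18) by (auto simp: measurable_def sets_restrict_space subset_eq image_iff Int_commute)
  note [measurable] = measurable_compose[OF measurable_snd \<sigma>_meas]
  have diff_meas: "(\<lambda>(\<xi>, p). \<xi> - p) \<in> borel_measurable (\<nu> \<Otimes>\<^sub>M \<sigma>)"
  proof -
    have "(\<lambda>z. (fst z, snd z)) \<in> \<nu> \<Otimes>\<^sub>M \<sigma> \<rightarrow>\<^sub>M borel \<Otimes>\<^sub>M (borel :: 'a dual measure)"
      by measurable
    from measurable_compose[OF this borel_measurable_diff_pair] show ?thesis
      by (simp add: split_beta)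
  qed
  from measurable_compose[OF this G_meas]
  have [measurable]: "(\<lambda>z. G (fst z - snd z)) \<in> borel_measurable (\<nu> \<Otimes>\<^sub>M \<sigma>)"
    by (simp add: split_beta)
  define \<Phi> where "\<Phi> \<xi> = (\<integral>\<^sup>+p. ennreal ((cmod (G (\<xi> - p)))\<^sup>2) \<partial>\<sigma>)" for \<xi>
  have [measurable]: "\<Phi> \<in> borel_measurable \<nu>"
    unfolding \<Phi>_def by (rule \<sigma>.borel_measurable_nn_integral) (unfold split_beta, measurable)
  have bounds: "ennreal A * sqn \<nu> (fourier \<mu> u) \<le> sqn (density \<nu> \<Phi>) (fourier \<mu> u)"
      "sqn (density \<nu> \<Phi>) (fourier \<mu> u) \<le> ennreal B * sqn \<nu> (fourier \<mu> u)"
    if u: "u \<in> L1_functions \<mu> \<inter> L2_functions \<mu>" for u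
  proof -
    have [measurable]: "fourier \<mu> u \<in> borel_measurable borel"
      using L2_functions_measurable[OF fourier_unitary_L2[OF unitary u]]
      by (simp add: measurable_cong_sets[OF haar_sets(1)[OF assms(3)] refl])
    let ?f = "\<lambda>p \<xi>. ennreal ((cmod (fourier \<mu> u \<xi>))\<^sup>2) * ennreal ((cmod (G (\<xi> - p)))\<^sup>2)"
    \<comment> \<open>Modulation by \<open>p\<close> shifts the transform of \<open>u\<close> by
      \<open>p\<close>; translating \<open>\<xi>\<close> back moves the shift to
      \<open>G\<close>.\<close>
    have "sqn \<mu> (corr (\<lambda>t. u t * cnj (pairing p t)) g) = (\<integral>\<^sup>+\<xi>. ?f p \<xi> \<partial>\<nu>)" for p
    proof -
      have [measurable]: "(\<lambda>\<xi>. G (\<xi> - p)) \<in> borel_measurable borel"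
        using measurable_compose[OF borel_measurable_translate[of "- p"] G_meas] by simp
      have "sqn \<mu> (corr (\<lambda>t. u t * cnj (pairing p t)) g) =
          sqn \<nu> (\<lambda>\<xi>. fourier \<mu> u (p + \<xi>) * cnj (G \<xi>))"
        using sqn_corr[OF unitary L1_L2_functions_modulate[OF u] g G] by (simp add: fourier_modulate)
      also have "\<dots> = (\<integral>\<^sup>+\<xi>. ?f p (p + \<xi>) \<partial>\<nu>)"
        by (simp add: sqn_def norm_mult power_mult_distrib ennreal_mult)
      also have "\<dots> = (\<integral>\<^sup>+\<xi>. ?f p \<xi> \<partial>\<nu>)"
        by (rule haar_nn_integral_translate[OF assms(3) borel_measurable_translate]) measurable
      finally show ?thesis .
    qed
    then have "(\<integral>\<^sup>+p. sqn \<mu> (corr (\<lambda>t. u t * cnj (pairing p t)) g) \<partial>\<sigma>) = (\<integral>\<^sup>+p. (\<integral>\<^sup>+\<xi>. ?f p \<xi> \<partial>\<nu>) \<partial>\<sigma>)"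
      by simp
    also have "\<dots> = (\<integral>\<^sup>+\<xi>. (\<integral>\<^sup>+p. ?f p \<xi> \<partial>\<sigma>) \<partial>\<nu>)"
      by (rule \<nu>\<sigma>.Fubini') (unfold split_beta, measurable)
    also have "\<dots> = (\<integral>\<^sup>+\<xi>. \<Phi> \<xi> * ennreal ((cmod (fourier \<mu> u \<xi>))\<^sup>2) \<partial>\<nu>)"
    proof (rule nn_integral_cong)
      fix \<xi>
      assume "\<xi> \<in> space \<nu>"
      then have "Pair \<xi> \<in> \<sigma> \<rightarrow>\<^sub>M \<nu> \<Otimes>\<^sub>M \<sigma>" by (rule measurable_Pair1')
      from measurable_compose[OF this measurable_compose[OF diff_meas G_meas]]
      have [measurable]: "(\<lambda>p. G (\<xi> - p)) \<in> borel_measurable \<sigma>" by simp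
      show "(\<integral>\<^sup>+p. ?f p \<xi> \<partial>\<sigma>) = \<Phi> \<xi> * ennreal ((cmod (fourier \<mu> u \<xi>))\<^sup>2)"
        unfolding \<Phi>_def by (subst nn_integral_cmult) (auto simp: mult.commute)
    qed
    also have "\<dots> = sqn (density \<nu> \<Phi>) (fourier \<mu> u)"
      by (rule sqn_density[symmetric]) measurable
    finally have E: "(\<integral>\<^sup>+p. sqn \<mu> (corr (\<lambda>t. u t * cnj (pairing p t)) g) \<partial>\<sigma>) =
        sqn (density \<nu> \<Phi>) (fourier \<mu> u)" .
    have sqn_u: "sqn \<nu> (fourier \<mu> u) = ennreal ((L2_norm \<mu> u)\<^sup>2)"
      using u by (simp add: fourier_unitary_sqn[OF unitary] sqn_eq_L2_norm)
    have "u \<in> L2_functions \<mu>" using u by simp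
    note averaged = gabor_frame_averaged[OF assms(5-8,10,11,19,20) g this assms(25)]
    show "ennreal A * sqn \<nu> (fourier \<mu> u) \<le> sqn (density \<nu> \<Phi>) (fourier \<mu> u)"
      "sqn (density \<nu> \<Phi>) (fourier \<mu> u) \<le> ennreal B * sqn \<nu> (fourier \<mu> u)"
      using averaged A assms(24) by (simp_all add: E sqn_u ennreal_mult)
  qed
  have "AE \<xi> in \<nu>. ennreal A \<le> \<Phi> \<xi> \<and> \<Phi> \<xi> \<le> ennreal B"
  proof (rule AE_bounds_of_set_integrals)
    fix S assume S[measurable]: "S \<in> sets \<nu>" and fin: "emeasure \<nu> S < \<infinity>"
    define H where "H = (indicator S :: 'a dual \<Rightarrow> complex)"
    have H_sq: "ennreal ((cmod (H \<xi>))\<^sup>2) = indicator S \<xi>" for \<xi>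
      by (simp add: H_def indicator_def)
    have [measurable]: "H \<in> borel_measurable \<nu>"
      unfolding H_def by measurable
    have sqn_H: "sqn \<nu> H = emeasure \<nu> S"
      by (simp add: sqn_def H_sq)
    have H: "H \<in> L2_functions \<nu>"
      using fin by (simp add: L2_functions_iff_sqn sqn_H)
    \<comment> \<open>Surjectivity in \<open>fourier_unitary\<close> writes \<open>H\<close> as an
      extended transform. Its defining approximants \<open>h n\<close> are integrable, so their
      transforms satisfy \<open>bounds\<close> and converge to \<open>H\<close>.\<close>
    obtain f where f: "f \<in> L2_functions \<mu>" and fH: "AE \<xi> in \<nu>. fourier_L2 \<mu> \<nu> f \<xi> = H \<xi>"
      using unitary H unfolding fourier_unitary_def by blast
    obtain h where h: "\<And>n. h n \<in> L1_functions \<mu> \<inter> L2_functions \<mu>"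
      and h_lim: "(\<lambda>n. sqn \<nu> (\<lambda>\<xi>. fourier \<mu> (h n) \<xi> - fourier_L2 \<mu> \<nu> f \<xi>)) \<longlonglongrightarrow> 0"
      using is_fourier_fourier_L2[OF sets_\<mu> unitary f] unfolding is_fourier_L2_iff_sqn[OF f] by blast
    have "sqn \<nu> (\<lambda>\<xi>. fourier \<mu> (h n) \<xi> - fourier_L2 \<mu> \<nu> f \<xi>) = sqn \<nu> (\<lambda>\<xi>. fourier \<mu> (h n) \<xi> - H \<xi>)" for n
      unfolding sqn_def using fH by (intro nn_integral_cong_AE) auto
    then have lim: "(\<lambda>n. sqn \<nu> (\<lambda>\<xi>. fourier \<mu> (h n) \<xi> - H \<xi>)) \<longlonglongrightarrow> 0"
      using h_lim by simp
    \<comment> \<open>By linearity a difference of transforms is again the transform of an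
      admissible function, so the upper bound controls convergence in the density as well.\<close>
    have diff: "sqn (density \<nu> \<Phi>) (\<lambda>\<xi>. fourier \<mu> (h m) \<xi> - fourier \<mu> (h n) \<xi>) \<le>
        ennreal B * sqn \<nu> (\<lambda>\<xi>. fourier \<mu> (h m) \<xi> - fourier \<mu> (h n) \<xi>)" for m n
      using bounds(2)[OF L1_L2_functions_diff[OF h h], of m n] h by (simp add: fourier_diff sets_\<mu>)
    have "ennreal A * sqn \<nu> H \<le> sqn (density \<nu> \<Phi>) H" "sqn (density \<nu> \<Phi>) H \<le> ennreal B * sqn \<nu> H"
      by (rule sqn_density_bounds_limit[OF _ A _ H lim _ _ diff];
          intro bounds h fourier_unitary_L2[OF unitary] \<open>\<Phi> \<in> borel_measurable \<nu>\<close>)+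
    then show "ennreal A * emeasure \<nu> S \<le> (\<integral>\<^sup>+\<xi>. \<Phi> \<xi> * indicator S \<xi> \<partial>\<nu>) \<and>
        (\<integral>\<^sup>+\<xi>. \<Phi> \<xi> * indicator S \<xi> \<partial>\<nu>) \<le> ennreal B * emeasure \<nu> S"
      by (simp add: sqn_H sqn_density H_sq)
  qed (auto intro: \<nu>.sigma_finite_measure_axioms)
  then show ?thesis
    by (simp add: \<Phi>_def G_def)
qed

end
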